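(* There exist no biharmonic $3$-type hypersurfaces $M^m$ in the unit Euclidean sphere $\mathbb{S}^{m+1}$.
   Context: All manifolds are smooth and connected; hypersurfaces are not assumed compact. Let $\varphi:M^m\to N$ be the inclusion of an $m$-dimensional submanifold in a Riemannian manifold $N$, with mean curvature vector field $H$ (so $mH$ is the trace of the second fundamental form). $M$ is biharmonic if $\Delta H+\operatorname{trace}R^N(d\varphi(\cdot),H)d\varphi(\cdot)=0$, where $\Delta V=-\operatorname{trace}\nabla^2V$ is the rough Laplacian on sections of $\varphi^{-1}(TN)$ and $R^N(X,Y)=[\nabla_X,\nabla_Y]-\nabla_{[X,Y]}$. (Here $N=\mathbb{S}^{m+1}$.) Finite type: a submanifold $M\subset\mathbb{R}^{n+1}$ with inclusion $\phi$ is of $k$-type if $\phi=\phi_0+\phi_{t_1}+\dots+\phi_{t_k}$, where $\phi_0\in\mathbb{R}^{n+1}$ is a constant vector, the $\phi_{t_i}:M\to\mathbb{R}^{n+1}$ are non-constant maps with $\Delta\phi_{t_i}=\lambda_{t_i}\phi_{t_i}$ ($\Delta=-\operatorname{trace}\nabla d$ the Laplacian of $M$, acting componentwise), and the real numbers $\lambda_{t_1},\dots,\lambda_{t_k}$ are mutually distinct. A submanifold of $\mathbb{S}^n$ is of $k$-type if it is so as a submanifold of $\mathbb{R}^{n+1}$ via the canonical inclusion $\mathbb{S}^n\subset\mathbb{R}^{n+1}$ (here $n=m+1$). *)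

theory Defs
  imports "HOL-Analysis.Analysis"
begin

(* Intended for open S only, where "differentiable_on" is differentiability at every point of S. *)
primrec C_diff_on :: "nat \<Rightarrow> 'a::euclidean_space set \<Rightarrow> ('a \<Rightarrow> 'b::euclidean_space) \<Rightarrow> bool" where
  "C_diff_on 0 S f \<longleftrightarrow> continuous_on S f"
| "C_diff_on (Suc k) S f \<longleftrightarrow>
     f differentiable_on S \<and> (\<forall>v. C_diff_on k S (\<lambda>x. frechet_derivative f (at x) v))"

definition smooth_on :: "'a::euclidean_space set \<Rightarrow> ('a \<Rightarrow> 'b::euclidean_space) \<Rightarrow> bool" where
  "smooth_on S f \<longleftrightarrow> (\<forall>k. C_diff_on k S f)"

definition pd :: "'m::finite \<Rightarrow> (real^'m \<Rightarrow> 'b::euclidean_space) \<Rightarrow> real^'m \<Rightarrow> 'b" where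
  "pd i f u = frechet_derivative f (at u) (axis i 1)"

(* A submanifold of a Euclidean space is given by its manifold topology M; its underlying set is
   topspace M. The topology need not be the subspace topology, so injectively immersed
   submanifolds are covered; embedded ones are the case M = top_of_set (topspace M).
   Given M, there is exactly one smooth structure for which the inclusion is an immersion. Its
   maximal atlas consists of (the inverses of) the maps x with chart M W x. *)
definition chart ::
  "'a::euclidean_space topology \<Rightarrow> (real^'m) set \<Rightarrow> (real^'m \<Rightarrow> 'a) \<Rightarrow> bool" where
  "chart M W x \<longleftrightarrow>
     open W \<and> openin M (x ` W) \<and>
     homeomorphic_map (top_of_set W) (subtopology M (x ` W)) x \<and>
     smooth_on W x \<and> (\<forall>u\<in>W. inj (frechet_derivative x (at u)))"

(* Connected submanifold of dimension CARD('m) *)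
definition submanifold :: "'m::finite itself \<Rightarrow> 'a::euclidean_space topology \<Rightarrow> bool" where
  "submanifold _ M \<longleftrightarrow>
     connected_space M \<and> Hausdorff_space M \<and> second_countable M \<and>
     (\<forall>p\<in>topspace M. \<exists>W (x :: real^'m \<Rightarrow> 'a). chart M W x \<and> p \<in> x ` W)"

(* Induced metric, Levi-Civita connection and Laplacian, written in the coordinates of a chart x.
   Functions on M and sections along M are represented by their pull-backs by x. *)

definition metric :: "(real^'m \<Rightarrow> 'a::euclidean_space) \<Rightarrow> real^'m \<Rightarrow> real^'m^'m" where
  "metric x u = (\<chi> i j. pd i x u \<bullet> pd j x u)"

definition mtrace ::
  "(real^'m \<Rightarrow> 'a::euclidean_space) \<Rightarrow> real^'m \<Rightarrow> ('m \<Rightarrow> 'm \<Rightarrow> 'b::real_vector) \<Rightarrow> 'b" where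
  "mtrace x u h = (\<Sum>i\<in>UNIV. \<Sum>j\<in>UNIV. (matrix_inv (metric x u) $ i $ j) *\<^sub>R h i j)"

definition christoffel ::
  "(real^'m \<Rightarrow> 'a::euclidean_space) \<Rightarrow> 'm \<Rightarrow> 'm \<Rightarrow> 'm \<Rightarrow> real^'m \<Rightarrow> real" where
  "christoffel x k i j u =
     (1/2) * (\<Sum>l\<in>UNIV. matrix_inv (metric x u) $ k $ l *
        (pd i (\<lambda>v. metric x v $ j $ l) u + pd j (\<lambda>v. metric x v $ i $ l) u
         - pd l (\<lambda>v. metric x v $ i $ j) u))"

(* - trace (nabla d F) *)
definition laplacian ::
  "(real^'m \<Rightarrow> 'a::euclidean_space) \<Rightarrow> (real^'m \<Rightarrow> 'b::euclidean_space) \<Rightarrow> real^'m \<Rightarrow> 'b" where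
  "laplacian x F u =
     - mtrace x u (\<lambda>i j. pd i (pd j F) u - (\<Sum>k\<in>UNIV. christoffel x k i j u *\<^sub>R pd k F u))"

(* The unit sphere. Its Levi-Civita connection is the tangential part of the derivative in the
   ambient space; tan_proj y is the orthogonal projection onto the tangent space at y. *)

definition tan_proj :: "'a::euclidean_space \<Rightarrow> 'a \<Rightarrow> 'a" where
  "tan_proj y v = v - (v \<bullet> y) *\<^sub>R y"

definition sphere_conn ::
  "('a::euclidean_space \<Rightarrow> 'a) \<Rightarrow> ('a \<Rightarrow> 'a) \<Rightarrow> 'a \<Rightarrow> 'a" where
  "sphere_conn X Z y = tan_proj y (frechet_derivative Z (at y) (X y))"

definition lie_bracket ::
  "('a::euclidean_space \<Rightarrow> 'a) \<Rightarrow> ('a \<Rightarrow> 'a) \<Rightarrow> 'a \<Rightarrow> 'a" where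
  "lie_bracket X Y y = frechet_derivative Y (at y) (X y) - frechet_derivative X (at y) (Y y)"

definition sphere_curv_fields ::
  "('a::euclidean_space \<Rightarrow> 'a) \<Rightarrow> ('a \<Rightarrow> 'a) \<Rightarrow> ('a \<Rightarrow> 'a) \<Rightarrow> 'a \<Rightarrow> 'a" where
  "sphere_curv_fields X Y Z y =
     sphere_conn X (sphere_conn Y Z) y - sphere_conn Y (sphere_conn X Z) y
     - sphere_conn (lie_bracket X Y) Z y"

(* R(a,b)c at the point y, for a, b, c tangent to the sphere at y. By tensoriality any extension
   of a, b, c to tangent vector fields may be used; the one taken is z |-> tan_proj z a, etc. *)
definition sphere_curv :: "'a::euclidean_space \<Rightarrow> 'a \<Rightarrow> 'a \<Rightarrow> 'a \<Rightarrow> 'a" where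
  "sphere_curv y a b c =
     sphere_curv_fields (\<lambda>z. tan_proj z a) (\<lambda>z. tan_proj z b) (\<lambda>z. tan_proj z c) y"

(* Covariant derivative, in the i-th coordinate direction, of a section V of the pull-back to M
   of the tangent bundle of the sphere *)
definition cov ::
  "(real^'m \<Rightarrow> 'a::euclidean_space) \<Rightarrow> 'm \<Rightarrow> (real^'m \<Rightarrow> 'a) \<Rightarrow> real^'m \<Rightarrow> 'a" where
  "cov x i V u = tan_proj (x u) (pd i V u)"

(* Second fundamental form of M in the sphere: the component in directions i, j of nabla d phi *)
definition second_ff ::
  "(real^'m \<Rightarrow> 'a::euclidean_space) \<Rightarrow> 'm \<Rightarrow> 'm \<Rightarrow> real^'m \<Rightarrow> 'a" where
  "second_ff x i j u = cov x i (pd j x) u - (\<Sum>k\<in>UNIV. christoffel x k i j u *\<^sub>R pd k x u)"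

definition mean_curvature ::
  "(real^'m \<Rightarrow> 'a::euclidean_space) \<Rightarrow> real^'m \<Rightarrow> 'a" where
  "mean_curvature x u = (1 / real CARD('m)) *\<^sub>R mtrace x u (\<lambda>i j. second_ff x i j u)"

definition rough_laplacian ::
  "(real^'m \<Rightarrow> 'a::euclidean_space) \<Rightarrow> (real^'m \<Rightarrow> 'a) \<Rightarrow> real^'m \<Rightarrow> 'a" where
  "rough_laplacian x V u =
     - mtrace x u (\<lambda>i j. cov x i (cov x j V) u - (\<Sum>k\<in>UNIV. christoffel x k i j u *\<^sub>R cov x k V u))"

(* The expressions below are tensorial, so requiring the equations in all charts is the same as
   requiring them in one chart around each point. *)

definition biharmonic :: "'m::finite itself \<Rightarrow> 'a::euclidean_space topology \<Rightarrow> bool" where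
  "biharmonic _ M \<longleftrightarrow>
     (\<forall>W (x :: real^'m \<Rightarrow> 'a). chart M W x \<longrightarrow>
        (\<forall>u\<in>W. rough_laplacian x (mean_curvature x) u
            + mtrace x u (\<lambda>i j. sphere_curv (x u) (pd i x u) (mean_curvature x u) (pd j x u)) = 0))"

definition smooth_map ::
  "'m::finite itself \<Rightarrow> 'a::euclidean_space topology \<Rightarrow> ('a \<Rightarrow> 'b::euclidean_space) \<Rightarrow> bool" where
  "smooth_map _ M F \<longleftrightarrow>
     (\<forall>W (x :: real^'m \<Rightarrow> 'a). chart M W x \<longrightarrow> smooth_on W (F \<circ> x))"

definition eigenmap ::
  "'m::finite itself \<Rightarrow> 'a::euclidean_space topology \<Rightarrow> real \<Rightarrow> ('a \<Rightarrow> 'b::euclidean_space) \<Rightarrow> bool" where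
  "eigenmap t M \<mu> F \<longleftrightarrow> smooth_map t M F \<and>
     (\<forall>W (x :: real^'m \<Rightarrow> 'a). chart M W x \<longrightarrow>
        (\<forall>u\<in>W. laplacian x (F \<circ> x) u = \<mu> *\<^sub>R F (x u)))"

definition finite_type ::
  "'m::finite itself \<Rightarrow> nat \<Rightarrow> 'a::euclidean_space topology \<Rightarrow> bool" where
  "finite_type t k M \<longleftrightarrow>
     (\<exists>(c :: 'a) (F :: nat \<Rightarrow> 'a \<Rightarrow> 'a) (\<mu> :: nat \<Rightarrow> real).
        inj_on \<mu> {..<k} \<and>
        (\<forall>i<k. eigenmap t M (\<mu> i) (F i) \<and> \<not> F i constant_on topspace M) \<and>
        (\<forall>p\<in>topspace M. p = c + (\<Sum>i<k. F i p)))"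

end

(* Let D be the Laplacian of M, H the mean curvature vector and q = |H|^2. Biharmonicity amounts to the two
   vector equations D x = m x - m H and D H = m H - m q x, so that (D - m)^2 x = m^2 q x. A decomposition
   x = c + x_1 + x_2 + x_3 with distinct eigenvalues gives D^3 x - s1 D^2 x + s2 D x - s3 (x - c) = 0.
   Its tangential part says that h - 2 m^2 q is locally constant, where h = s3 <c, x>; its component along x
   makes m^2 D q + h affine in q, and its component along H makes s3 <c, H> quadratic in q with leading
   coefficient m^3. Since 2 m^2 D q = D h = m h - m s3 <c, H>, the function q locally satisfies a quadratic
   equation with constant coefficients, hence it is constant. Then every eigenvalue solves
   (t - m)^2 = m^2 q, which has at most two solutions. *)

theory Submission
  imports Defs
begin

subsection \<open>Partial derivatives\<close>

text \<open>\<open>H\<close> is kept as a vector of the ambient Euclidean space. The equation for D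
  H then carries the normal and the tangential part of biharmonicity together, and the shape
  operator and its norm never appear. Differentiating \<open>H\<close> from its definition would
  mean differentiating Christoffel symbols and an inverse matrix. Finite type avoids this: m H = m x
  - D x is a linear combination of \<open>x\<close> and the eigenmaps, hence smooth enough. All
  later maps are polynomial in these, so a product rule for D suffices. The quadratic equation for q
  cannot degenerate, as its leading coefficient is m^4. Its constant term may change from ball to
  ball, but finitely many values and continuity make q constant on each ball, and connectedness of
  \<open>M\<close> then makes it constant on \<open>M\<close>. The last step has a trap.
  \<open>M\<close> may be noncompact, so a nonconstant eigenmap may have eigenvalue 0, and the
  powers of D do not separate it from the constant \<open>c\<close>. Such an eigenmap is treated by
  the undifferentiated identity, which would make it constant.\<close>

lemma frechet_derivative_cong_on_open:
  assumes "open S" "u \<in> S" "\<And>v. v \<in> S \<Longrightarrow> f v = g v"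
  shows "frechet_derivative f (at u) = frechet_derivative g (at u)"
proof -
  \<comment> \<open>\<open>frechet_derivative\<close> is a choice among such \<open>D\<close>, so
    equivalent predicates give the same map, even where no derivative exists.\<close>
  have "(f has_derivative D) (at u) \<longleftrightarrow> (g has_derivative D) (at u)" for D
    using has_derivative_transform_within_open[of f D u UNIV S g]
      has_derivative_transform_within_open[of g D u UNIV S f] assms
    by auto
  then show ?thesis
    by (simp add: frechet_derivative_def)
qed

lemma pd_cong_on_open:
  assumes "open S" "u \<in> S" "\<And>v. v \<in> S \<Longrightarrow> f v = g v"
  shows "pd i f u = pd i g u"
  unfolding pd_def using frechet_derivative_cong_on_open[OF assms] by simp

lemma differentiable_cong_on_open:
  assumes "open S" "u \<in> S" "\<And>v. v \<in> S \<Longrightarrow> f v = g v" "f differentiable (at u)"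
  shows "g differentiable (at u)"
  using assms has_derivative_transform_within_open[of f _ u UNIV S g]
  unfolding differentiable_def by blast

lemma pd_eqI: "(f has_derivative D) (at u) \<Longrightarrow> pd i f u = D (axis i 1)"
  unfolding pd_def using frechet_derivative_at by metis

lemma has_derivative_pd:
  "f differentiable (at u) \<Longrightarrow> (f has_derivative frechet_derivative f (at u)) (at u)"
  by (simp add: frechet_derivative_works)

lemma pd_const [simp]: "pd i (\<lambda>u. c) u = 0"
  by (simp add: pd_def)

lemma pd_add:
  assumes "f differentiable (at u)" "g differentiable (at u)"
  shows "pd i (\<lambda>u. f u + g u) u = pd i f u + pd i g u"
  using pd_eqI[OF has_derivative_add[OF has_derivative_pd[OF assms(1)] has_derivative_pd[OF assms(2)]]]
  by (simp add: pd_def)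

lemma pd_bounded_linear:
  assumes "bounded_linear h" "f differentiable (at u)"
  shows "pd i (\<lambda>u. h (f u)) u = h (pd i f u)"
  using pd_eqI[OF bounded_linear.has_derivative[OF assms(1) has_derivative_pd[OF assms(2)]]]
  by (simp add: pd_def)

lemma pd_bounded_bilinear:
  assumes "bounded_bilinear h" "f differentiable (at u)" "g differentiable (at u)"
  shows "pd i (\<lambda>u. h (f u) (g u)) u = h (f u) (pd i g u) + h (pd i f u) (g u)"
  using pd_eqI[OF bounded_bilinear.FDERIV[OF assms(1) has_derivative_pd[OF assms(2)]
      has_derivative_pd[OF assms(3)]]]
  by (simp add: pd_def)

lemma frechet_derivative_eq_sum_pd:
  assumes "f differentiable (at u)"
  shows "frechet_derivative f (at u) v = (\<Sum>i\<in>UNIV. (v $ i) *\<^sub>R pd i f u)"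
proof -
  interpret linear "frechet_derivative f (at u)"
    using assms by (rule linear_frechet_derivative)
  have "v = (\<Sum>i\<in>UNIV. (v $ i) *\<^sub>R axis i 1)"
    by (simp add: basis_expansion scalar_mult_eq_scaleR[symmetric])
  then have "frechet_derivative f (at u) v
      = frechet_derivative f (at u) (\<Sum>i\<in>UNIV. (v $ i) *\<^sub>R axis i 1)"
    by simp
  then show ?thesis
    by (simp add: sum scale pd_def)
qed

section \<open>Symmetry of mixed second partial derivatives\<close>

lemma pd_line:
  assumes "f differentiable (at (a + t *\<^sub>R axis i 1))"
  shows "((\<lambda>s. f (a + s *\<^sub>R axis i 1)) has_vector_derivative pd i f (a + t *\<^sub>R axis i 1)) (at t)"
proof -
  let ?D = "frechet_derivative f (at (a + t *\<^sub>R axis i 1))"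
  have "((\<lambda>s. a + s *\<^sub>R axis i 1) has_derivative (\<lambda>s. s *\<^sub>R axis i 1)) (at t)"
    by (auto intro!: derivative_eq_intros)
  from has_derivative_compose[OF this has_derivative_pd[OF assms]]
  have "((\<lambda>s. f (a + s *\<^sub>R axis i 1)) has_derivative (\<lambda>s. ?D (s *\<^sub>R axis i 1))) (at t)" .
  moreover have "?D (s *\<^sub>R axis i 1) = s *\<^sub>R ?D (axis i 1)" for s
    using linear_frechet_derivative[OF assms] by (simp add: linear.scaleR)
  ultimately show ?thesis
    by (simp add: has_vector_derivative_def pd_def)
qed

text \<open>The second difference over a square is symmetric in \<open>i\<close> and
  \<open>j\<close>. The mean value theorem, used in direction \<open>i\<close> and then in direction
  \<open>j\<close>, turns it into a mixed derivative at an interior point; exchanging the roles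
  gives the other order of differentiation.\<close>

lemma second_difference:
  fixes f :: "real^'m::finite \<Rightarrow> real"
  assumes t: "0 < t"
    and box: "\<And>r s. 0 \<le> r \<Longrightarrow> r \<le> t \<Longrightarrow> 0 \<le> s \<Longrightarrow> s \<le> t \<Longrightarrow> a + r *\<^sub>R axis i 1 + s *\<^sub>R axis j 1 \<in> S"
    and f: "\<And>v. v \<in> S \<Longrightarrow> f differentiable (at v)"
    and fi: "\<And>v. v \<in> S \<Longrightarrow> pd i f differentiable (at v)"
  obtains r s where "0 < r" "r < t" "0 < s" "s < t"
    "f (a + t *\<^sub>R axis i 1 + t *\<^sub>R axis j 1) - f (a + t *\<^sub>R axis i 1) - f (a + t *\<^sub>R axis j 1) + f a
      = t\<^sup>2 * pd j (pd i f) (a + r *\<^sub>R axis i 1 + s *\<^sub>R axis j 1)"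
proof -
  let ?e = "axis i 1 :: real^'m" and ?e' = "axis j 1 :: real^'m"
  define g where "g r = f (a + t *\<^sub>R ?e' + r *\<^sub>R ?e) - f (a + r *\<^sub>R ?e)" for r
  have inS: "a + r *\<^sub>R ?e \<in> S" "a + t *\<^sub>R ?e' + r *\<^sub>R ?e \<in> S" if "0 \<le> r" "r \<le> t" for r
    using box[of r 0] box[of r t] that t by (auto simp: algebra_simps)
  have "DERIV g r :> pd i f (a + t *\<^sub>R ?e' + r *\<^sub>R ?e) - pd i f (a + r *\<^sub>R ?e)"
    if "0 \<le> r" "r \<le> t" for r
    unfolding g_def has_real_derivative_iff_has_vector_derivative
    by (intro has_vector_derivative_diff pd_line f inS that)
  from MVT2[OF t this] obtain r where r: "0 < r" "r < t"
    and gr: "g t - g 0 = t * (pd i f (a + t *\<^sub>R ?e' + r *\<^sub>R ?e) - pd i f (a + r *\<^sub>R ?e))"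
    by auto
  have "DERIV (\<lambda>s. pd i f (a + r *\<^sub>R ?e + s *\<^sub>R ?e')) s :> pd j (pd i f) (a + r *\<^sub>R ?e + s *\<^sub>R ?e')"
    if "0 \<le> s" "s \<le> t" for s
    unfolding has_real_derivative_iff_has_vector_derivative
    by (intro pd_line fi box) (use that r in auto)
  from MVT2[OF t this] obtain s where s: "0 < s" "s < t"
    and gs: "pd i f (a + r *\<^sub>R ?e + t *\<^sub>R ?e') - pd i f (a + r *\<^sub>R ?e)
      = t * pd j (pd i f) (a + r *\<^sub>R ?e + s *\<^sub>R ?e')"
    by auto
  have "g t - g 0 = t\<^sup>2 * pd j (pd i f) (a + r *\<^sub>R ?e + s *\<^sub>R ?e')"
    using gr gs by (simp add: power2_eq_square algebra_simps)
  then show thesis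
    using that[OF r s] by (simp add: g_def algebra_simps)
qed

lemma pd_commute_real:
  fixes f :: "real^'m::finite \<Rightarrow> real"
  assumes S: "open S" "u \<in> S"
    and f: "\<And>v. v \<in> S \<Longrightarrow> f differentiable (at v)"
    and fi: "\<And>k v. v \<in> S \<Longrightarrow> pd k f differentiable (at v)"
    and cont: "\<And>k l. continuous_on S (pd k (pd l f))"
  shows "pd i (pd j f) u = pd j (pd i f) u"
proof (rule ccontr)
  let ?e = "axis i 1 :: real^'m" and ?e' = "axis j 1 :: real^'m"
  let ?A = "pd i (pd j f)" and ?B = "pd j (pd i f)"
  assume "?A u \<noteq> ?B u"
  \<comment> \<open>Half the gap: two values within \<open>d\<close> of \<open>?A u\<close> and
    \<open>?B u\<close> cannot coincide.\<close>
  define d where "d = \<bar>?A u - ?B u\<bar> / 2"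
  have d: "d > 0" using \<open>?A u \<noteq> ?B u\<close> by (simp add: d_def)
  have "\<exists>\<epsilon>>0. \<forall>v\<in>S. dist v u < \<epsilon> \<longrightarrow> dist (g v) (g u) < d" if "continuous_on S g" for g :: "real^'m \<Rightarrow> real"
    using that S(2) d unfolding continuous_on_iff by blast
  from this[OF cont[of i j]] this[OF cont[of j i]] obtain \<epsilon>1 \<epsilon>2 where
    e: "\<epsilon>1 > 0" "\<epsilon>2 > 0"
      "\<And>v. v \<in> S \<Longrightarrow> dist v u < \<epsilon>1 \<Longrightarrow> dist (?A v) (?A u) < d"
      "\<And>v. v \<in> S \<Longrightarrow> dist v u < \<epsilon>2 \<Longrightarrow> dist (?B v) (?B u) < d"
    by metis
  obtain \<epsilon>3 where e3: "\<epsilon>3 > 0" "ball u \<epsilon>3 \<subseteq> S"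
    using S open_contains_ball by blast
  define \<epsilon> where "\<epsilon> = min \<epsilon>1 (min \<epsilon>2 \<epsilon>3)"
  \<comment> \<open>A point of the square is at distance at most 2t from \<open>u\<close>, which is
    less than \<open>\<epsilon>\<close>.\<close>
  define t where "t = \<epsilon> / 3"
  have t: "t > 0" using e e3 by (simp add: t_def \<epsilon>_def)
  have near: "dist (u + r *\<^sub>R axis k 1 + s *\<^sub>R axis l 1) u < \<epsilon>"
    if "0 \<le> r" "r \<le> t" "0 \<le> s" "s \<le> t" for r s and k l :: 'm
  proof -
    have "dist (u + r *\<^sub>R axis k 1 + s *\<^sub>R axis l 1) u
        = norm (r *\<^sub>R (axis k 1 :: real^'m) + s *\<^sub>R axis l 1)"
      by (simp add: dist_norm)
    also have "\<dots> \<le> norm (r *\<^sub>R (axis k 1 :: real^'m)) + norm (s *\<^sub>R (axis l 1 :: real^'m))"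
      by (rule norm_triangle_ineq)
    also have "\<dots> < \<epsilon>"
      using that t by (simp add: norm_axis_1 t_def)
    finally show ?thesis .
  qed
  have box: "u + r *\<^sub>R axis k 1 + s *\<^sub>R axis l 1 \<in> S"
    if "0 \<le> r" "r \<le> t" "0 \<le> s" "s \<le> t" for r s and k l :: 'm
    using near[OF that, of k l] e3 by (auto simp: \<epsilon>_def dist_commute subset_iff)
  obtain r s where rs: "0 < r" "r < t" "0 < s" "s < t"
    "f (u + t *\<^sub>R ?e + t *\<^sub>R ?e') - f (u + t *\<^sub>R ?e) - f (u + t *\<^sub>R ?e') + f u
      = t\<^sup>2 * ?B (u + r *\<^sub>R ?e + s *\<^sub>R ?e')"
    using second_difference[of t u i j S f, OF t box f fi] by blast
  obtain r' s' where rs': "0 < r'" "r' < t" "0 < s'" "s' < t"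
    "f (u + t *\<^sub>R ?e' + t *\<^sub>R ?e) - f (u + t *\<^sub>R ?e') - f (u + t *\<^sub>R ?e) + f u
      = t\<^sup>2 * ?A (u + r' *\<^sub>R ?e' + s' *\<^sub>R ?e)"
    using second_difference[of t u j i S f, OF t box f fi] by blast
  have "t\<^sup>2 * ?B (u + r *\<^sub>R ?e + s *\<^sub>R ?e') = t\<^sup>2 * ?A (u + r' *\<^sub>R ?e' + s' *\<^sub>R ?e)"
    using rs(5) rs'(5) by (simp add: algebra_simps)
  then have "?B (u + r *\<^sub>R ?e + s *\<^sub>R ?e') = ?A (u + r' *\<^sub>R ?e' + s' *\<^sub>R ?e)"
    using t by simp
  moreover have "dist (?B (u + r *\<^sub>R ?e + s *\<^sub>R ?e')) (?B u) < d"
    using rs near[of r s i j] by (intro e(4) box) (auto simp: \<epsilon>_def)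
  moreover have "dist (?A (u + r' *\<^sub>R ?e' + s' *\<^sub>R ?e)) (?A u) < d"
    using rs' near[of r' s' j i] by (intro e(3) box) (auto simp: \<epsilon>_def)
  ultimately show False
    unfolding d_def dist_real_def by argo
qed

lemma pd_commute:
  fixes f :: "real^'m::finite \<Rightarrow> 'b::euclidean_space"
  assumes S: "open S" "u \<in> S"
    and f: "\<And>v. v \<in> S \<Longrightarrow> f differentiable (at v)"
    and fi: "\<And>k v. v \<in> S \<Longrightarrow> pd k f differentiable (at v)"
    and cont: "\<And>k l. continuous_on S (pd k (pd l f))"
  shows "pd i (pd j f) u = pd j (pd i f) u"
proof (rule euclidean_eqI)
  fix b :: 'b
  have 1: "pd k (\<lambda>v. f v \<bullet> b) v = pd k f v \<bullet> b" if "v \<in> S" for k v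
    by (rule pd_bounded_linear[OF bounded_linear_inner_left f[OF that]])
  have 2: "pd k (pd l (\<lambda>v. f v \<bullet> b)) v = pd k (pd l f) v \<bullet> b" if "v \<in> S" for k l v
    using pd_cong_on_open[where i = k, OF S(1) that 1[where k = l]]
      pd_bounded_linear[OF bounded_linear_inner_left[of b] fi[OF that, of l], where i = k] by simp
  have 3: "pd k (\<lambda>v. f v \<bullet> b) differentiable (at v)" if "v \<in> S" for k v
  proof -
    have "(\<lambda>v. pd k f v \<bullet> b) differentiable (at v)"
      by (intro differentiable_inner fi that) simp
    then show ?thesis
      by (rule differentiable_cong_on_open[rotated -1]) (use S(1) that 1 in auto)
  qed
  have "pd i (pd j (\<lambda>v. f v \<bullet> b)) u = pd j (pd i (\<lambda>v. f v \<bullet> b)) u"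
  proof (rule pd_commute_real[OF S])
    show "continuous_on S (pd k (pd l (\<lambda>v. f v \<bullet> b)))" for k l
      by (rule continuous_on_eq[of S "\<lambda>v. pd k (pd l f) v \<bullet> b"])
        (auto intro!: continuous_on_inner cont simp: 2)
  qed (auto intro!: differentiable_inner f 3)
  then show "pd i (pd j f) u \<bullet> b = pd j (pd i f) u \<bullet> b"
    using 2[OF S(2)] by simp
qed

text \<open>Just the regularity that the linear and product rules for the Laplacian use. It is
  inherited by sums and bounded bilinear products, which is easier to verify than
  smoothness.\<close>

definition twice_diff_on :: "(real^'m::finite) set \<Rightarrow> (real^'m \<Rightarrow> 'b::euclidean_space) \<Rightarrow> bool" where
  "twice_diff_on S f \<longleftrightarrow>
     (\<forall>u\<in>S. f differentiable (at u) \<and> (\<forall>i. pd i f differentiable (at u)))"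

lemma twice_diff_onD:
  assumes "twice_diff_on S f" "u \<in> S"
  shows "f differentiable (at u)" "pd i f differentiable (at u)"
  using assms by (auto simp: twice_diff_on_def)

lemma twice_diff_on_continuous_on: "twice_diff_on S f \<Longrightarrow> continuous_on S f"
  by (meson continuous_at_imp_continuous_on differentiable_imp_continuous_within twice_diff_onD(1))

lemma twice_diff_on_cong:
  assumes "open S" "\<And>v. v \<in> S \<Longrightarrow> f v = g v" "twice_diff_on S f"
  shows "twice_diff_on S g"
  unfolding twice_diff_on_def
proof (intro ballI conjI allI)
  fix u i assume u: "u \<in> S"
  show "g differentiable (at u)"
    using differentiable_cong_on_open[OF assms(1) u assms(2)] twice_diff_onD(1)[OF assms(3) u] by simp
  have "pd i f v = pd i g v" if "v \<in> S" for v
    by (rule pd_cong_on_open[OF assms(1) that assms(2)])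
  then show "pd i g differentiable (at u)"
    by (rule differentiable_cong_on_open[OF assms(1) u _ twice_diff_onD(2)[OF assms(3) u]])
qed

lemma twice_diff_on_const [simp]: "twice_diff_on S (\<lambda>u. c)"
  by (simp add: twice_diff_on_def pd_const[abs_def])

lemma twice_diff_on_add:
  assumes "open S" "twice_diff_on S f" "twice_diff_on S g"
  shows "twice_diff_on S (\<lambda>u. f u + g u)"
  unfolding twice_diff_on_def
proof (intro ballI conjI allI)
  fix u i assume u: "u \<in> S"
  show "(\<lambda>u. f u + g u) differentiable (at u)"
    using assms u by (simp add: twice_diff_on_def)
  show "pd i (\<lambda>u. f u + g u) differentiable (at u)"
    by (rule differentiable_cong_on_open[OF \<open>open S\<close> u, of "\<lambda>u. pd i f u + pd i g u"])
      (use assms u in \<open>auto simp: twice_diff_on_def pd_add\<close>)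
qed

lemma twice_diff_on_bounded_linear:
  assumes "open S" "bounded_linear h" "twice_diff_on S f"
  shows "twice_diff_on S (\<lambda>u. h (f u))"
  unfolding twice_diff_on_def
proof (intro ballI conjI allI)
  fix u i assume u: "u \<in> S"
  have h: "(\<lambda>u. h (g u)) differentiable (at u)" if "g differentiable (at u)" for g
    using that bounded_linear.has_derivative[OF assms(2)] unfolding differentiable_def by blast
  show "(\<lambda>u. h (f u)) differentiable (at u)"
    by (rule h[OF twice_diff_onD(1)[OF assms(3) u]])
  show "pd i (\<lambda>u. h (f u)) differentiable (at u)"
    by (rule differentiable_cong_on_open[OF \<open>open S\<close> u, of "\<lambda>u. h (pd i f u)"])
      (use assms u h in \<open>auto simp: twice_diff_on_def pd_bounded_linear\<close>)
qed

lemma twice_diff_on_bounded_bilinear: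
  assumes "open S" "bounded_bilinear h" "twice_diff_on S f" "twice_diff_on S g"
  shows "twice_diff_on S (\<lambda>u. h (f u) (g u))"
  unfolding twice_diff_on_def
proof (intro ballI conjI allI)
  fix u i assume u: "u \<in> S"
  have h: "(\<lambda>u. h (f u) (g u)) differentiable (at u)"
    if "f differentiable (at u)" "g differentiable (at u)" for f g
    using that bounded_bilinear.FDERIV[OF assms(2)] unfolding differentiable_def by blast
  show "(\<lambda>u. h (f u) (g u)) differentiable (at u)"
    by (rule h) (use assms u in \<open>auto simp: twice_diff_on_def\<close>)
  show "pd i (\<lambda>u. h (f u) (g u)) differentiable (at u)"
    by (rule differentiable_cong_on_open[OF \<open>open S\<close> u, of "\<lambda>u. h (f u) (pd i g u) + h (pd i f u) (g u)"])
      (use assms u in \<open>auto simp: twice_diff_on_def pd_bounded_bilinear intro!: differentiable_add h\<close>)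
qed

lemma twice_diff_on_sum:
  assumes "open S" "\<And>j. j \<in> J \<Longrightarrow> twice_diff_on S (f j)"
  shows "twice_diff_on S (\<lambda>u. \<Sum>j\<in>J. f j u)"
  using assms(2)
  by (induction J rule: infinite_finite_induct) (auto intro!: twice_diff_on_add assms(1))

lemmas twice_diff_on_scaleR = twice_diff_on_bounded_bilinear[OF _ bounded_bilinear_scaleR]
lemmas twice_diff_on_scaleR_const = twice_diff_on_bounded_linear[OF _ bounded_linear_scaleR_right]
lemmas twice_diff_on_inner = twice_diff_on_bounded_bilinear[OF _ bounded_bilinear_inner]

section \<open>Second partial derivatives of sums and products\<close>

lemma pd_pd_add:
  assumes "open S" "u \<in> S" "twice_diff_on S f" "twice_diff_on S g"
  shows "pd i (pd j (\<lambda>u. f u + g u)) u = pd i (pd j f) u + pd i (pd j g) u"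
proof -
  have "pd i (pd j (\<lambda>u. f u + g u)) u = pd i (\<lambda>u. pd j f u + pd j g u) u"
    by (rule pd_cong_on_open[OF assms(1,2)]) (use assms in \<open>auto simp: twice_diff_on_def pd_add\<close>)
  then show ?thesis
    using assms by (simp add: twice_diff_on_def pd_add)
qed

lemma pd_pd_bounded_linear:
  assumes "open S" "u \<in> S" "bounded_linear h" "twice_diff_on S f"
  shows "pd i (pd j (\<lambda>u. h (f u))) u = h (pd i (pd j f) u)"
proof -
  have "pd i (pd j (\<lambda>u. h (f u))) u = pd i (\<lambda>u. h (pd j f u)) u"
    by (rule pd_cong_on_open[OF assms(1,2)]) (use assms in \<open>auto simp: twice_diff_on_def pd_bounded_linear\<close>)
  then show ?thesis
    using assms by (simp add: twice_diff_on_def pd_bounded_linear)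
qed

lemma pd_pd_bounded_bilinear:
  assumes "open S" "u \<in> S" and h: "bounded_bilinear h" and f: "twice_diff_on S f" and g: "twice_diff_on S g"
  shows "pd i (pd j (\<lambda>u. h (f u) (g u))) u =
    h (pd i (pd j f) u) (g u) + h (pd i f u) (pd j g u) + h (pd j f u) (pd i g u) + h (f u) (pd i (pd j g) u)"
proof -
  have d: "(\<lambda>u. h (f u) (g u)) differentiable (at u)"
    if "f differentiable (at u)" "g differentiable (at u)" for f g
    using that bounded_bilinear.FDERIV[OF h] unfolding differentiable_def by blast
  have "pd i (pd j (\<lambda>u. h (f u) (g u))) u = pd i (\<lambda>u. h (f u) (pd j g u) + h (pd j f u) (g u)) u"
    by (rule pd_cong_on_open[OF assms(1,2)]) (use assms in \<open>auto simp: twice_diff_on_def pd_bounded_bilinear\<close>)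
  also have "\<dots> = pd i (\<lambda>u. h (f u) (pd j g u)) u + pd i (\<lambda>u. h (pd j f u) (g u)) u"
    by (intro pd_add d twice_diff_onD[OF f] twice_diff_onD[OF g] \<open>u \<in> S\<close>)
  also have "\<dots> = h (f u) (pd i (pd j g) u) + h (pd i f u) (pd j g u)
      + (h (pd j f u) (pd i g u) + h (pd i (pd j f) u) (g u))"
    by (simp add: pd_bounded_bilinear[OF h] twice_diff_onD[OF f \<open>u \<in> S\<close>] twice_diff_onD[OF g \<open>u \<in> S\<close>])
  finally show ?thesis by (simp add: add_ac)
qed

section \<open>Consequences of smoothness\<close>

lemma smooth_on_imp_differentiable:
  assumes "open S" "smooth_on S f" "u \<in> S"
  shows "f differentiable (at u)"
proof -
  have "C_diff_on (Suc 0) S f" using assms by (simp only: smooth_on_def)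
  then show ?thesis
    using assms(3) at_within_open[OF assms(3,1)] by (auto simp: differentiable_on_def)
qed

lemma smooth_on_pd: "smooth_on S f \<Longrightarrow> smooth_on S (pd i f)"
  unfolding smooth_on_def pd_def by (metis C_diff_on.simps(2))

lemma smooth_on_imp_continuous_on: "smooth_on S f \<Longrightarrow> continuous_on S f"
  by (metis C_diff_on.simps(1) smooth_on_def)

lemma smooth_on_imp_twice_diff_on: "open S \<Longrightarrow> smooth_on S f \<Longrightarrow> twice_diff_on S f"
  by (simp add: twice_diff_on_def smooth_on_imp_differentiable smooth_on_pd)

lemma pd_commute_smooth_on:
  assumes "open S" "u \<in> S" "smooth_on S f"
  shows "pd i (pd j f) u = pd j (pd i f) u"
  using assms
  by (intro pd_commute[of S] smooth_on_imp_differentiable[of S] smooth_on_imp_continuous_on smooth_on_pd)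

subsection \<open>The Laplacian\<close>

lemma mtrace_add: "mtrace x u (\<lambda>i j. h i j + k i j) = mtrace x u h + mtrace x u k"
  by (simp add: mtrace_def scaleR_add_right sum.distrib)

lemma mtrace_linear:
  assumes "linear f"
  shows "f (mtrace x u h) = mtrace x u (\<lambda>i j. f (h i j))"
  by (simp add: mtrace_def linear_sum[OF assms] linear.scaleR[OF assms] o_def)

lemma mtrace_diff: "mtrace x u (\<lambda>i j. h i j - k i j) = mtrace x u h - mtrace x u k"
  by (simp add: mtrace_def scaleR_diff_right sum_subtractf)

lemma mtrace_uminus: "mtrace x u (\<lambda>i j. - h i j) = - mtrace x u h"
  by (simp add: mtrace_def sum_negf)

lemma mtrace_zero [simp]: "mtrace x u (\<lambda>i j. 0) = 0"
  by (simp add: mtrace_def)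

text \<open>The components of nabla dF. For \<open>F = x\<close> this is the second fundamental form
  of M in the ambient Euclidean space.\<close>

definition hess where
  "hess x F u i j = pd i (pd j F) u - (\<Sum>k\<in>UNIV. christoffel x k i j u *\<^sub>R pd k F u)"

lemma laplacian_eq_hess: "laplacian x F u = - mtrace x u (hess x F u)"
  by (simp add: laplacian_def hess_def[abs_def])

lemma hess_cong:
  assumes "open S" "u \<in> S" "\<And>v. v \<in> S \<Longrightarrow> f v = g v"
  shows "hess x f u i j = hess x g u i j"
proof -
  have 1: "pd k f v = pd k g v" if "v \<in> S" for k v
    by (rule pd_cong_on_open[OF assms(1) that assms(3)])
  show ?thesis
    using pd_cong_on_open[where i = i, OF assms(1,2) 1[where k = j]] 1 \<open>u \<in> S\<close> by (simp add: hess_def)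
qed

lemma laplacian_cong:
  assumes "open S" "u \<in> S" "\<And>v. v \<in> S \<Longrightarrow> f v = g v"
  shows "laplacian x f u = laplacian x g u"
proof -
  have "hess x f u = hess x g u"
    by (intro ext hess_cong[OF assms(1,2)] assms(3))
  then show ?thesis
    by (simp add: laplacian_eq_hess)
qed

lemma laplacian_const [simp]: "laplacian x (\<lambda>u. c) u = 0"
  by (simp add: laplacian_def pd_const[abs_def])

lemma laplacian_add:
  assumes "open S" "u \<in> S" "twice_diff_on S f" "twice_diff_on S g"
  shows "laplacian x (\<lambda>u. f u + g u) u = laplacian x f u + laplacian x g u"
proof -
  have "hess x (\<lambda>u. f u + g u) u = (\<lambda>i j. hess x f u i j + hess x g u i j)"
    by (intro ext) (simp add: hess_def pd_pd_add[OF assms] pd_add twice_diff_onD[OF assms(3,2)]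
        twice_diff_onD[OF assms(4,2)] scaleR_add_right sum.distrib)
  then show ?thesis
    by (simp add: laplacian_eq_hess mtrace_add)
qed

lemma laplacian_bounded_linear:
  assumes "open S" "u \<in> S" "bounded_linear h" "twice_diff_on S f"
  shows "laplacian x (\<lambda>u. h (f u)) u = h (laplacian x f u)"
proof -
  interpret bounded_linear h by fact
  have "hess x (\<lambda>u. h (f u)) u = (\<lambda>i j. h (hess x f u i j))"
    by (intro ext) (simp add: hess_def pd_pd_bounded_linear[OF assms] pd_bounded_linear[OF assms(3)]
        twice_diff_onD[OF assms(4,2)] diff sum scaleR)
  then show ?thesis
    using mtrace_linear[OF linear_axioms, of x u "hess x f u"] by (simp add: laplacian_eq_hess neg)
qed

lemma laplacian_sum:
  assumes "open S" "u \<in> S" "\<And>j. j \<in> J \<Longrightarrow> twice_diff_on S (f j)"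
  shows "laplacian x (\<lambda>u. \<Sum>j\<in>J. f j u) u = (\<Sum>j\<in>J. laplacian x (f j) u)"
  using assms(3)
  by (induction J rule: infinite_finite_induct)
    (auto simp: laplacian_add[OF assms(1,2)] twice_diff_on_sum[OF assms(1)])

text \<open>The cross term stays symmetrised in \<open>i\<close> and \<open>j\<close>, as the
  second-order product rule delivers it. The rule is later applied to the field q x.\<close>

lemma laplacian_bounded_bilinear:
  assumes "open S" "u \<in> S" and h: "bounded_bilinear h" and f: "twice_diff_on S f" and g: "twice_diff_on S g"
  shows "laplacian x (\<lambda>u. h (f u) (g u)) u = h (laplacian x f u) (g u) + h (f u) (laplacian x g u)
    - mtrace x u (\<lambda>i j. h (pd i f u) (pd j g u) + h (pd j f u) (pd i g u))"
proof -
  interpret bounded_bilinear h by fact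
  have *: "hess x (\<lambda>u. h (f u) (g u)) u = (\<lambda>i j. h (hess x f u i j) (g u) + h (f u) (hess x g u i j)
    + (h (pd i f u) (pd j g u) + h (pd j f u) (pd i g u)))"
    by (intro ext) (simp add: hess_def pd_pd_bounded_bilinear[OF assms] pd_bounded_bilinear[OF h]
        twice_diff_onD[OF f \<open>u \<in> S\<close>] twice_diff_onD[OF g \<open>u \<in> S\<close>] diff_left diff_right sum_left sum_right
        scaleR_left scaleR_right scaleR_add_right sum.distrib)
  show ?thesis
    using mtrace_linear[OF bounded_linear.linear[OF bounded_linear_left], of x u "hess x f u" "g u"]
      mtrace_linear[OF bounded_linear.linear[OF bounded_linear_right], of "f u" x u "hess x g u"]
    by (simp add: laplacian_eq_hess * mtrace_add minus_left minus_right)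
qed

subsection \<open>Submanifolds of the sphere\<close>

lemma matrix_inv_inverse:
  fixes A :: "real^'m^'m"
  assumes "invertible A"
  shows "A ** matrix_inv A = mat 1" "matrix_inv A ** A = mat 1"
  using someI_ex[OF assms[unfolded invertible_def]] by (simp_all add: matrix_inv_def)

lemma matrix_inv_sum:
  fixes A :: "real^'m^'m"
  assumes "invertible A"
  shows "(\<Sum>k\<in>UNIV. A $ i $ k * matrix_inv A $ k $ j) = (if i = j then 1 else 0)"
    and "(\<Sum>k\<in>UNIV. matrix_inv A $ i $ k * A $ k $ j) = (if i = j then 1 else 0)"
  using matrix_inv_inverse[OF assms] by (simp_all add: matrix_matrix_mult_def mat_def vec_eq_iff)

section \<open>Curvature of the unit sphere\<close>

lemma frechet_derivative_tan_proj:
  "frechet_derivative (\<lambda>z. tan_proj z c) (at z) v = - (c \<bullet> v) *\<^sub>R z - (c \<bullet> z) *\<^sub>R v"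
proof -
  have "((\<lambda>z. tan_proj z c) has_derivative (\<lambda>v. - (c \<bullet> v) *\<^sub>R z - (c \<bullet> z) *\<^sub>R v)) (at z)"
    unfolding tan_proj_def by (auto intro!: derivative_eq_intros simp: algebra_simps)
  then show ?thesis
    by (metis frechet_derivative_at)
qed

text \<open>At \<open>y\<close> the chosen extensions have derivatives normal to the sphere in
  tangent directions, so their first covariant derivatives vanish there. The second one survives
  because the normal direction itself turns when the base point moves along
  \<open>a\<close>.\<close>

lemma sphere_conn_sphere_conn:
  fixes y a b c :: "'a::euclidean_space"
  assumes "y \<bullet> y = 1" "a \<bullet> y = 0" "b \<bullet> y = 0" "c \<bullet> y = 0"
  shows "sphere_conn (\<lambda>z. tan_proj z a) (sphere_conn (\<lambda>z. tan_proj z b) (\<lambda>z. tan_proj z c)) y = - (a \<bullet> c) *\<^sub>R b"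
proof -
  \<comment> \<open>\<open>K\<close> is the ambient derivative of the extension of \<open>c\<close>
    along that of \<open>b\<close>; \<open>P\<close> is its tangential part.\<close>
  define K where "K = (\<lambda>z. - (c \<bullet> tan_proj z b) *\<^sub>R z - (c \<bullet> z) *\<^sub>R tan_proj z b)"
  define P where "P = (\<lambda>z. K z - (K z \<bullet> z) *\<^sub>R z)"
  have P: "sphere_conn (\<lambda>z. tan_proj z b) (\<lambda>z. tan_proj z c) = P"
    by (simp add: sphere_conn_def[abs_def] frechet_derivative_tan_proj) (simp add: P_def K_def tan_proj_def)
  \<comment> \<open>The derivative of \<open>K\<close> at \<open>y\<close>. In the second summand of
    \<open>K\<close>, the derivative of \<open>tan_proj z b\<close> carries the factor
    \<open>c \<bullet> y = 0\<close>.\<close>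
  define D where "D = (\<lambda>v. - (c \<bullet> (- (b \<bullet> v) *\<^sub>R y)) *\<^sub>R y - (b \<bullet> c) *\<^sub>R v - (c \<bullet> v) *\<^sub>R b)"
  have ty: "tan_proj y w = w" if "w \<bullet> y = 0" for w
    using that by (simp add: tan_proj_def)
  have t: "((\<lambda>z. tan_proj z b) has_derivative (\<lambda>v. - (b \<bullet> v) *\<^sub>R y)) (at y)"
    unfolding tan_proj_def by (auto intro!: derivative_eq_intros simp: assms algebra_simps)
  have ct: "((\<lambda>z. - (c \<bullet> tan_proj z b)) has_derivative (\<lambda>v. - (c \<bullet> (- (b \<bullet> v) *\<^sub>R y)))) (at y)"
    by (intro has_derivative_minus has_derivative_inner_right t)
  have cz: "((\<lambda>z. c \<bullet> z) has_derivative (\<lambda>v. c \<bullet> v)) (at y)"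
    by (intro has_derivative_inner_right has_derivative_ident)
  have K: "(K has_derivative D) (at y)"
    unfolding K_def
    using has_derivative_diff[OF has_derivative_scaleR[OF ct has_derivative_ident] has_derivative_scaleR[OF cz t]]
    by (simp add: D_def ty assms inner_commute algebra_simps)
  have Ky: "K y = - (b \<bullet> c) *\<^sub>R y"
    using assms by (simp add: K_def ty inner_commute)
  have Kz: "((\<lambda>z. K z \<bullet> z) has_derivative (\<lambda>v. K y \<bullet> v + D v \<bullet> y)) (at y)"
    by (rule has_derivative_inner[OF K has_derivative_ident])
  have DP: "(P has_derivative (\<lambda>v. D v - ((K y \<bullet> y) *\<^sub>R v + (K y \<bullet> v + D v \<bullet> y) *\<^sub>R y))) (at y)"
    unfolding P_def
    by (rule has_derivative_diff[OF K has_derivative_scaleR[OF Kz has_derivative_ident]])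
  have "frechet_derivative P (at y) a = D a - ((K y \<bullet> y) *\<^sub>R a + (K y \<bullet> a + D a \<bullet> y) *\<^sub>R y)"
    by (simp only: frechet_derivative_at[OF DP, symmetric])
  also have "\<dots> = - (a \<bullet> c) *\<^sub>R b"
    using assms by (simp add: D_def Ky inner_diff_left inner_diff_right inner_commute)
  finally show ?thesis
    using assms by (simp add: P sphere_conn_def[of _ P] ty)
qed

text \<open>Constant curvature 1: antisymmetrising the previous formula in \<open>a\<close> and
  \<open>b\<close> leaves these two terms.\<close>

lemma sphere_curv_eq:
  fixes y a b c :: "'a::euclidean_space"
  assumes "y \<bullet> y = 1" "a \<bullet> y = 0" "b \<bullet> y = 0" "c \<bullet> y = 0"
  shows "sphere_curv y a b c = (b \<bullet> c) *\<^sub>R a - (a \<bullet> c) *\<^sub>R b"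
proof -
  \<comment> \<open>Vanishing at \<open>y\<close> is enough: \<open>sphere_conn X Z y\<close>
    depends on \<open>X\<close> only through \<open>X y\<close>.\<close>
  have "lie_bracket (\<lambda>z. tan_proj z a) (\<lambda>z. tan_proj z b) y = 0"
    using assms
    by (simp add: lie_bracket_def frechet_derivative_tan_proj) (simp add: tan_proj_def inner_commute)
  moreover have "sphere_conn (\<lambda>z. 0) Z y = 0" if "Z = (\<lambda>z. tan_proj z c)" for Z
    by (simp add: sphere_conn_def that frechet_derivative_tan_proj) (simp add: tan_proj_def)
  ultimately show ?thesis
    using assms
    by (simp add: sphere_curv_def sphere_curv_fields_def sphere_conn_sphere_conn)
      (simp add: sphere_conn_def frechet_derivative_tan_proj tan_proj_def)
qed

section \<open>Geometry of one chart of a submanifold of the sphere\<close>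

locale spherical_immersion =
  fixes x :: "real^'m::finite \<Rightarrow> 'a::euclidean_space" and W :: "(real^'m) set"
  assumes open_W: "open W"
    and smooth: "smooth_on W x"
    and inj: "u \<in> W \<Longrightarrow> inj (frechet_derivative x (at u))"
    and sphere: "u \<in> W \<Longrightarrow> x u \<in> sphere 0 1"
begin

abbreviation "H \<equiv> mean_curvature x"

lemma twice_diff_on_x: "twice_diff_on W x"
  by (rule smooth_on_imp_twice_diff_on[OF open_W smooth])

lemma twice_diff_on_pd_x: "twice_diff_on W (pd i x)"
  by (rule smooth_on_imp_twice_diff_on[OF open_W smooth_on_pd[OF smooth]])

lemma pd_inner:
  assumes "u \<in> W" "twice_diff_on W f" "twice_diff_on W g"
  shows "pd i (\<lambda>v. f v \<bullet> g v) u = f u \<bullet> pd i g u + pd i f u \<bullet> g u"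
  by (rule pd_bounded_bilinear[OF bounded_bilinear_inner])
    (use assms in \<open>auto simp: twice_diff_on_def\<close>)

text \<open>Source of the orthogonality relations: a derivative moves across a constant scalar
  product at the cost of a sign.\<close>

lemma pd_inner_const:
  assumes "u \<in> W" "f differentiable (at u)" "g differentiable (at u)" "\<And>v. v \<in> W \<Longrightarrow> f v \<bullet> g v = c"
  shows "pd i f u \<bullet> g u = - (f u \<bullet> pd i g u)"
proof -
  have "pd i (\<lambda>v. f v \<bullet> g v) u = pd i (\<lambda>v. c) u"
    by (rule pd_cong_on_open[OF open_W assms(1,4)])
  then show ?thesis
    using pd_bounded_bilinear[OF bounded_bilinear_inner assms(2,3), of i] by simp
qed

lemma x_inner_x: "u \<in> W \<Longrightarrow> x u \<bullet> x u = 1"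
  using sphere[of u] by (simp add: norm_eq_sqrt_inner)

lemma pd_x_inner_x: "u \<in> W \<Longrightarrow> pd i x u \<bullet> x u = 0"
  using pd_inner_const[of u x x 1 i] twice_diff_onD[OF twice_diff_on_x, of u] x_inner_x
  by (simp add: inner_commute)

lemma pd_pd_x_inner_x:
  assumes "u \<in> W"
  shows "pd i (pd j x) u \<bullet> x u = - metric x u $ i $ j"
  using pd_inner_const[of u "pd j x" x 0 i] twice_diff_onD[OF twice_diff_on_x assms] assms pd_x_inner_x
  by (simp add: metric_def inner_commute)

lemma pd_pd_x_commute: "u \<in> W \<Longrightarrow> pd i (pd j x) u = pd j (pd i x) u"
  by (rule pd_commute_smooth_on[OF open_W _ smooth])

lemma metric_commute: "metric x u $ i $ j = metric x u $ j $ i"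
  by (simp add: metric_def inner_commute)

text \<open>The metric is a Gram matrix: its quadratic form at \<open>v\<close> is the squared
  length of dx(v), and dx is injective.\<close>

lemma invertible_metric:
  assumes u: "u \<in> W"
  shows "invertible (metric x u)"
proof -
  have D: "x differentiable (at u)"
    by (rule twice_diff_onD[OF twice_diff_on_x u])
  have "v = 0" if "metric x u *v v = 0" for v
  proof -
    have "0 = (\<Sum>i\<in>UNIV. v $ i * (metric x u *v v) $ i)"
      using that by simp
    also have "\<dots> = (\<Sum>i\<in>UNIV. v $ i *\<^sub>R pd i x u) \<bullet> (\<Sum>i\<in>UNIV. v $ i *\<^sub>R pd i x u)"
      by (simp add: matrix_vector_mult_def metric_def inner_sum_left inner_sum_right sum_distrib_left
          mult_ac inner_commute)
    finally have "frechet_derivative x (at u) v = 0"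
      by (simp add: frechet_derivative_eq_sum_pd[OF D])
    then show ?thesis
      using inj[OF u] linear_frechet_derivative[OF D] linear_0 by (metis injD)
  qed
  then show ?thesis
    unfolding invertible_left_inverse matrix_left_invertible_ker by blast
qed

text \<open>Raising and then lowering an index. The two versions contract the metric with either
  slot of its inverse, one through each of the two inverse identities.\<close>

lemma mtrace_mult_metric:
  assumes "u \<in> W"
  shows "mtrace x u (\<lambda>i j. a i * metric x u $ j $ k) = a k"
    and "mtrace x u (\<lambda>i j. a j * metric x u $ i $ k) = a k"
proof -
  let ?g = "metric x u" and ?h = "matrix_inv (metric x u)"
  have "mtrace x u (\<lambda>i j. a i * ?g $ j $ k) = (\<Sum>i\<in>UNIV. a i * (\<Sum>j\<in>UNIV. ?h $ i $ j * ?g $ j $ k))"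
    by (simp add: mtrace_def sum_distrib_left mult_ac)
  then show "mtrace x u (\<lambda>i j. a i * ?g $ j $ k) = a k"
    by (simp add: matrix_inv_sum[OF invertible_metric[OF assms]] if_distrib cong: if_cong)
  have "mtrace x u (\<lambda>i j. a j * ?g $ i $ k) = (\<Sum>i\<in>UNIV. \<Sum>j\<in>UNIV. a j * (?g $ k $ i * ?h $ i $ j))"
    by (simp add: mtrace_def metric_commute[of u k] mult_ac)
  also have "\<dots> = (\<Sum>j\<in>UNIV. a j * (\<Sum>i\<in>UNIV. ?g $ k $ i * ?h $ i $ j))"
    by (subst sum.swap) (simp add: sum_distrib_left)
  finally show "mtrace x u (\<lambda>i j. a j * ?g $ i $ k) = a k"
    by (simp add: matrix_inv_sum[OF invertible_metric[OF assms]] if_distrib cong: if_cong)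
qed

lemma mtrace_metric:
  assumes "u \<in> W"
  shows "mtrace x u (\<lambda>i j. metric x u $ i $ j) = real CARD('m)"
  using matrix_inv_sum(2)[OF invertible_metric[OF assms]]
  by (simp add: mtrace_def metric_commute[of u])

lemma pd_metric:
  assumes "u \<in> W"
  shows "pd i (\<lambda>v. metric x v $ j $ l) u = pd j x u \<bullet> pd i (pd l x) u + pd i (pd j x) u \<bullet> pd l x u"
  using pd_inner[OF assms twice_diff_on_pd_x twice_diff_on_pd_x] by (simp add: metric_def)

text \<open>Gauss formula: the Christoffel terms are exactly the tangential part of the second
  derivatives of \<open>x\<close>.\<close>

lemma hess_x_inner_pd_x:
  assumes u: "u \<in> W"
  shows "hess x x u i j \<bullet> pd l x u = 0"
proof -
  let ?g = "metric x u" and ?h = "matrix_inv (metric x u)"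
  \<comment> \<open>Each derivative of the metric splits into two scalar products; by symmetry of
    second derivatives, four of the six cancel and the other two agree.\<close>
  have christoffel: "christoffel x k i j u = (\<Sum>n\<in>UNIV. ?h $ k $ n * (pd i (pd j x) u \<bullet> pd n x u))" for k
    unfolding christoffel_def sum_distrib_left
  proof (rule sum.cong)
    fix n
    show "1 / 2 * (?h $ k $ n * (pd i (\<lambda>v. metric x v $ j $ n) u + pd j (\<lambda>v. metric x v $ i $ n) u
        - pd n (\<lambda>v. metric x v $ i $ j) u)) = ?h $ k $ n * (pd i (pd j x) u \<bullet> pd n x u)"
      by (simp add: pd_metric[OF u] pd_pd_x_commute[OF u, of n] pd_pd_x_commute[OF u, of j i] inner_commute)
  qed simp
  have "(\<Sum>k\<in>UNIV. christoffel x k i j u *\<^sub>R pd k x u) \<bullet> pd l x u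
      = (\<Sum>k\<in>UNIV. \<Sum>n\<in>UNIV. (?g $ l $ k * ?h $ k $ n) * (pd i (pd j x) u \<bullet> pd n x u))"
    unfolding inner_sum_left inner_scaleR_left christoffel sum_distrib_right
    by (intro sum.cong refl) (simp add: metric_def inner_commute mult_ac)
  also have "\<dots> = (\<Sum>n\<in>UNIV. (\<Sum>k\<in>UNIV. ?g $ l $ k * ?h $ k $ n) * (pd i (pd j x) u \<bullet> pd n x u))"
    by (subst sum.swap) (simp add: sum_distrib_right)
  also have "\<dots> = pd i (pd j x) u \<bullet> pd l x u"
    by (simp add: matrix_inv_sum[OF invertible_metric[OF u]] if_distrib[of "\<lambda>t. t * _"] cong: if_cong)
  finally show ?thesis
    by (simp add: hess_def inner_diff_left)
qed

lemma hess_x_inner_x: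
  assumes u: "u \<in> W"
  shows "hess x x u i j \<bullet> x u = - metric x u $ i $ j"
  by (simp add: hess_def inner_diff_left inner_sum_left pd_x_inner_x[OF u] pd_pd_x_inner_x[OF u])

lemma inner_mtrace:
  fixes b :: "'b::real_inner"
  shows "mtrace x u h \<bullet> b = mtrace x u (\<lambda>i j. h i j \<bullet> b)"
  using mtrace_linear[OF bounded_linear.linear[OF bounded_linear_inner_left], of x u h b] .

lemma mtrace_scaleR:
  fixes b :: "'b::real_normed_vector"
  shows "mtrace x u (\<lambda>i j. h i j *\<^sub>R b) = mtrace x u h *\<^sub>R b"
  using mtrace_linear[OF bounded_linear.linear[OF bounded_linear_scaleR_left], of x u h b] by simp

lemma laplacian_x_inner_pd_x: "u \<in> W \<Longrightarrow> laplacian x x u \<bullet> pd k x u = 0"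
  by (simp add: laplacian_eq_hess inner_mtrace hess_x_inner_pd_x)

lemma laplacian_x_inner_x: "u \<in> W \<Longrightarrow> laplacian x x u \<bullet> x u = real CARD('m)"
  by (simp add: laplacian_eq_hess inner_mtrace hess_x_inner_x mtrace_uminus mtrace_metric)

text \<open>Beltrami's formula with the contribution of the sphere split off: the Euclidean second
  fundamental form is \<open>second_ff\<close> minus the metric times \<open>x\<close>.\<close>

lemma laplacian_x:
  assumes u: "u \<in> W"
  shows "laplacian x x u = real CARD('m) *\<^sub>R x u - real CARD('m) *\<^sub>R H u"
proof -
  have "second_ff x i j u = hess x x u i j + metric x u $ i $ j *\<^sub>R x u" for i j
    by (simp add: second_ff_def cov_def tan_proj_def hess_def pd_pd_x_inner_x[OF u])
  then have "mtrace x u (\<lambda>i j. second_ff x i j u) = - laplacian x x u + real CARD('m) *\<^sub>R x u"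
    by (simp add: mtrace_add mtrace_scaleR mtrace_metric[OF u] laplacian_eq_hess)
  then show ?thesis
    by (simp add: mean_curvature_def algebra_simps)
qed

lemma H_eq: "u \<in> W \<Longrightarrow> H u = x u - (1 / real CARD('m)) *\<^sub>R laplacian x x u"
  by (simp add: laplacian_x scaleR_diff_right)

lemma H_inner_x: "u \<in> W \<Longrightarrow> H u \<bullet> x u = 0"
  by (simp add: H_eq inner_diff_left x_inner_x laplacian_x_inner_x)

lemma H_inner_pd_x: "u \<in> W \<Longrightarrow> H u \<bullet> pd k x u = 0"
  by (simp add: H_eq inner_diff_left laplacian_x_inner_pd_x) (metis inner_commute pd_x_inner_x)

text \<open>Because \<open>H\<close> is orthogonal to \<open>x\<close> and to M, its first
  derivatives are already tangent to the sphere, so projection only affects the second ones. Their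
  component along \<open>x\<close> is the second fundamental form paired with \<open>H\<close>, by
  moving derivatives across scalar products twice; its trace yields the term with |H|^2.\<close>

lemma rough_laplacian_H:
  assumes u: "u \<in> W" and H: "twice_diff_on W H"
  shows "rough_laplacian x H u = laplacian x H u + (real CARD('m) * (H u \<bullet> H u)) *\<^sub>R x u"
proof -
  have pd_H_x: "pd j H v \<bullet> x v = 0" if "v \<in> W" for j v
    using pd_inner_const[of v H x 0 j, OF that _ _ H_inner_x] H_inner_pd_x[OF that]
      twice_diff_onD[OF H that] twice_diff_onD[OF twice_diff_on_x that] by simp
  have cov: "cov x j H v = pd j H v" if "v \<in> W" for j v
    using pd_H_x[OF that] by (simp add: cov_def tan_proj_def)
  have pd_cov: "pd i (cov x j H) u = pd i (pd j H) u" for i j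
    by (rule pd_cong_on_open[OF open_W u cov])
  have pd_pd_H_x: "pd i (pd j H) u \<bullet> x u = hess x x u i j \<bullet> H u" for i j
  proof -
    have "pd i (pd j H) u \<bullet> x u = - (pd j H u \<bullet> pd i x u)"
      using pd_inner_const[of u "pd j H" x 0 i, OF u _ _ pd_H_x] twice_diff_onD[OF H u]
        twice_diff_onD[OF twice_diff_on_x u] by simp
    also have "\<dots> = H u \<bullet> pd j (pd i x) u"
      using pd_inner_const[of u H "pd i x" 0 j, OF u _ _ H_inner_pd_x] twice_diff_onD[OF H u]
        twice_diff_onD[OF twice_diff_on_x u] by simp
    also have "\<dots> = hess x x u i j \<bullet> H u"
      by (simp add: hess_def inner_diff_left inner_sum_left pd_pd_x_commute[OF u, of j]
          H_inner_pd_x[OF u] inner_commute inner_diff_right inner_sum_right)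
    finally show ?thesis .
  qed
  have hess_H: "cov x i (cov x j H) u - (\<Sum>k\<in>UNIV. christoffel x k i j u *\<^sub>R cov x k H u)
      = hess x H u i j - (hess x x u i j \<bullet> H u) *\<^sub>R x u" for i j
    by (simp add: cov_def[of x i "cov x j H"] cov[OF u] tan_proj_def pd_cov pd_pd_H_x hess_def[of x H])
  have "rough_laplacian x H u
      = - mtrace x u (\<lambda>i j. hess x H u i j - (hess x x u i j \<bullet> H u) *\<^sub>R x u)"
    by (simp add: rough_laplacian_def hess_H)
  also have "\<dots> = laplacian x H u - (laplacian x x u \<bullet> H u) *\<^sub>R x u"
    by (simp add: mtrace_diff mtrace_scaleR inner_mtrace laplacian_eq_hess)
  also have "laplacian x x u \<bullet> H u = - real CARD('m) * (H u \<bullet> H u)"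
    using H_inner_x[OF u] by (simp add: laplacian_x[OF u] inner_diff_left inner_diff_right inner_commute)
  finally show ?thesis by simp
qed

lemma mtrace_curv_H:
  assumes u: "u \<in> W"
  shows "mtrace x u (\<lambda>i j. sphere_curv (x u) (pd i x u) (H u) (pd j x u)) = - real CARD('m) *\<^sub>R H u"
proof -
  have "sphere_curv (x u) (pd i x u) (H u) (pd j x u) = (- metric x u $ i $ j) *\<^sub>R H u" for i j
    using sphere_curv_eq[of "x u" "pd i x u" "H u" "pd j x u"]
      x_inner_x[OF u] pd_x_inner_x[OF u] H_inner_x[OF u] H_inner_pd_x[OF u]
    by (simp add: metric_def)
  then show ?thesis
    by (simp add: mtrace_scaleR mtrace_uminus mtrace_metric[OF u])
qed

lemma laplacian_H:
  assumes "u \<in> W" "twice_diff_on W H"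
    and "rough_laplacian x H u
      + mtrace x u (\<lambda>i j. sphere_curv (x u) (pd i x u) (H u) (pd j x u)) = 0"
  shows "laplacian x H u = real CARD('m) *\<^sub>R H u - (real CARD('m) * (H u \<bullet> H u)) *\<^sub>R x u"
  using assms(3) unfolding rough_laplacian_H[OF assms(1,2)] mtrace_curv_H[OF assms(1)]
  by (simp add: algebra_simps)

end

subsection \<open>Biharmonic submanifolds of finite type\<close>

lemma laplacian_eq_0:
  assumes "open S" "u \<in> S" "\<And>k v. v \<in> S \<Longrightarrow> pd k f v = 0"
  shows "laplacian x f u = 0"
proof -
  have "pd i (pd j f) u = 0" for i j
    using pd_cong_on_open[where i = i, OF assms(1,2) assms(3)[where k = j]] by simp
  then show ?thesis
    using assms(3)[OF assms(2)] by (simp add: laplacian_def)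
qed

lemma constant_on_ball_if_pd_eq_0:
  assumes "\<And>v. v \<in> ball a r \<Longrightarrow> f differentiable (at v)"
    and "\<And>k v. v \<in> ball a r \<Longrightarrow> pd k f v = 0"
  shows "f constant_on ball a r"
proof -
  have "(f has_derivative (\<lambda>h. 0)) (at v within ball a r)" if "v \<in> ball a r" for v
  proof -
    have "frechet_derivative f (at v) = (\<lambda>h. 0)"
      using assms that by (intro ext) (simp add: frechet_derivative_eq_sum_pd)
    then have "(f has_derivative (\<lambda>h. 0)) (at v)"
      using has_derivative_pd[OF assms(1)[OF that]] by simp
    then show ?thesis
      by (rule has_derivative_at_withinI)
  qed
  from has_derivative_zero_constant[OF convex_ball this] show ?thesis
    by (auto simp: constant_on_def)
qed

lemma finite_quadratic_roots:
  fixes a b c :: real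
  assumes "a \<noteq> 0"
  shows "finite {t. a * t\<^sup>2 + b * t + c = 0}"
proof -
  have "finite {t. poly [:c, b, a:] t = 0}"
    by (rule poly_roots_finite) (use assms in simp)
  then show ?thesis
    by (simp add: power2_eq_square algebra_simps)
qed

text \<open>The whole situation pulled back to one chart, where D acts diagonally on combinations of
  the \<open>\<psi> j\<close>.\<close>

locale biharmonic_spectral = spherical_immersion x W
  for x :: "real^'m::finite \<Rightarrow> 'a::euclidean_space" and W +
  fixes J :: "'j set" and c :: 'a and \<psi> :: "'j \<Rightarrow> real^'m \<Rightarrow> 'a" and \<mu> :: "'j \<Rightarrow> real"
  assumes smooth_\<psi>: "j \<in> J \<Longrightarrow> smooth_on W (\<psi> j)"
    and laplacian_\<psi>: "j \<in> J \<Longrightarrow> u \<in> W \<Longrightarrow> laplacian x (\<psi> j) u = \<mu> j *\<^sub>R \<psi> j u"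
    and decomposition: "u \<in> W \<Longrightarrow> x u = c + (\<Sum>j\<in>J. \<psi> j u)"
    and biharmonic: "u \<in> W \<Longrightarrow> rough_laplacian x H u
      + mtrace x u (\<lambda>i j. sphere_curv (x u) (pd i x u) (H u) (pd j x u)) = 0"
begin

definition comb :: "('j \<Rightarrow> real) \<Rightarrow> real^'m \<Rightarrow> 'a" where
  "comb e u = (\<Sum>j\<in>J. e j *\<^sub>R \<psi> j u)"

text \<open>This is D^n x for positive \<open>n\<close>, and x - c for \<open>n = 0\<close>. As 0^0
  = 1, an eigenmap with eigenvalue 0 contributes to \<open>A 0\<close> only.\<close>

abbreviation A :: "nat \<Rightarrow> real^'m \<Rightarrow> 'a" where
  "A n \<equiv> comb (\<lambda>j. \<mu> j ^ n)"

definition q :: "real^'m \<Rightarrow> real" where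
  "q u = H u \<bullet> H u"

lemma twice_diff_on_\<psi>: "j \<in> J \<Longrightarrow> twice_diff_on W (\<psi> j)"
  by (rule smooth_on_imp_twice_diff_on[OF open_W smooth_\<psi>])

lemma twice_diff_on_comb: "twice_diff_on W (comb e)"
  unfolding comb_def[abs_def]
  by (intro twice_diff_on_sum twice_diff_on_scaleR_const twice_diff_on_\<psi> open_W)

lemma laplacian_comb:
  assumes "u \<in> W"
  shows "laplacian x (comb e) u = comb (\<lambda>j. e j * \<mu> j) u"
proof -
  have "laplacian x (comb e) u = (\<Sum>j\<in>J. laplacian x (\<lambda>u. e j *\<^sub>R \<psi> j u) u)"
    unfolding comb_def[abs_def]
    by (intro laplacian_sum[OF open_W assms] twice_diff_on_scaleR_const twice_diff_on_\<psi> open_W)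
  also have "\<dots> = (\<Sum>j\<in>J. e j *\<^sub>R \<mu> j *\<^sub>R \<psi> j u)"
    by (intro sum.cong refl)
      (simp add: laplacian_bounded_linear[OF open_W assms bounded_linear_scaleR_right twice_diff_on_\<psi>]
        laplacian_\<psi>[OF _ assms])
  finally show ?thesis
    by (simp add: comb_def)
qed

lemma laplacian_A: "u \<in> W \<Longrightarrow> laplacian x (A n) u = A (Suc n) u"
  by (simp add: laplacian_comb mult.commute)

lemma x_eq: "u \<in> W \<Longrightarrow> x u = c + A 0 u"
  by (simp add: decomposition comb_def)

lemma A_1:
  assumes "u \<in> W"
  shows "A 1 u = real CARD('m) *\<^sub>R x u - real CARD('m) *\<^sub>R H u"
proof -
  have "laplacian x x u = laplacian x (\<lambda>u. c + A 0 u) u"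
    by (rule laplacian_cong[OF open_W assms x_eq])
  also have "\<dots> = A 1 u"
    using laplacian_A[OF assms, of 0]
    by (simp add: laplacian_add[OF open_W assms twice_diff_on_const twice_diff_on_comb])
  finally show ?thesis
    by (simp add: laplacian_x[OF assms])
qed

lemma H_eq_A: "u \<in> W \<Longrightarrow> H u = x u - (1 / real CARD('m)) *\<^sub>R A 1 u"
  by (subst A_1) (simp_all add: scaleR_diff_right)

text \<open>Regularity is read off from \<open>A 1\<close>, a combination of eigenmaps, rather than
  from the definition of the mean curvature.\<close>

lemma twice_diff_on_H: "twice_diff_on W H"
proof (rule twice_diff_on_cong[OF open_W])
  show "twice_diff_on W (\<lambda>u. x u + (- 1 / real CARD('m)) *\<^sub>R A 1 u)"
    by (intro twice_diff_on_add twice_diff_on_x twice_diff_on_scaleR_const twice_diff_on_comb open_W)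
qed (simp add: H_eq_A)

lemma lap_H: "u \<in> W \<Longrightarrow> laplacian x H u = real CARD('m) *\<^sub>R H u - (real CARD('m) * q u) *\<^sub>R x u"
  unfolding q_def by (rule laplacian_H[OF _ twice_diff_on_H biharmonic])

lemma A_2:
  assumes u: "u \<in> W"
  shows "A 2 u = ((real CARD('m))\<^sup>2 * (1 + q u)) *\<^sub>R x u - (2 * (real CARD('m))\<^sup>2) *\<^sub>R H u"
proof -
  let ?m = "real CARD('m)"
  have "laplacian x (A 1) u = laplacian x (\<lambda>u. ?m *\<^sub>R x u + (- ?m) *\<^sub>R H u) u"
    by (rule laplacian_cong[OF open_W u]) (subst A_1, simp_all)
  also have "\<dots> = ?m *\<^sub>R laplacian x x u + (- ?m) *\<^sub>R laplacian x H u"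
    by (simp only: laplacian_add[OF open_W u] twice_diff_on_scaleR_const[OF open_W] twice_diff_on_x twice_diff_on_H
        laplacian_bounded_linear[OF open_W u bounded_linear_scaleR_right])
  finally have "A 2 u = ?m *\<^sub>R laplacian x x u - ?m *\<^sub>R laplacian x H u"
    using laplacian_A[OF u, of 1] by (simp add: numeral_2_eq_2)
  then show ?thesis
    by (simp add: laplacian_x[OF u] lap_H[OF u] algebra_simps power2_eq_square flip: scaleR_add_left)
qed

lemma twice_diff_on_q: "twice_diff_on W q"
  unfolding q_def[abs_def] by (intro twice_diff_on_inner twice_diff_on_H open_W)

text \<open>The gradient of q as an ambient vector tangent to M; half the symmetrised trace matches
  the cross term in the product rule.\<close>

definition grad_q :: "real^'m \<Rightarrow> 'a" where
  "grad_q u = (1 / 2) *\<^sub>R mtrace x u (\<lambda>i j. pd i q u *\<^sub>R pd j x u + pd j q u *\<^sub>R pd i x u)"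

lemma grad_q_inner:
  assumes u: "u \<in> W"
  shows "grad_q u \<bullet> x u = 0" "grad_q u \<bullet> H u = 0" "grad_q u \<bullet> pd k x u = pd k q u"
proof -
  show "grad_q u \<bullet> x u = 0" "grad_q u \<bullet> H u = 0"
    using pd_x_inner_x[OF u] H_inner_pd_x[OF u, unfolded inner_commute[of "H u"]]
    by (simp_all add: grad_q_def inner_mtrace inner_add_left)
  have "mtrace x u (\<lambda>i j. pd i q u *\<^sub>R pd j x u + pd j q u *\<^sub>R pd i x u) \<bullet> pd k x u
      = mtrace x u (\<lambda>i j. pd i q u * metric x u $ j $ k) + mtrace x u (\<lambda>i j. pd j q u * metric x u $ i $ k)"
    by (simp add: inner_mtrace inner_add_left metric_def flip: mtrace_add)
  then show "grad_q u \<bullet> pd k x u = pd k q u"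
    by (simp add: grad_q_def mtrace_mult_metric[OF u])
qed

text \<open>Applying D to the formula for \<open>A 2\<close>, only q x needs the product rule. The
  vectors \<open>x\<close>, \<open>H\<close> and \<open>grad_q\<close> are mutually orthogonal, so
  components can be separated.\<close>

lemma A_3:
  assumes u: "u \<in> W"
  shows "A 3 u = (real CARD('m))\<^sup>2 *\<^sub>R ((laplacian x q u + 3 * real CARD('m) * q u + real CARD('m)) *\<^sub>R x u
    - (real CARD('m) * (3 + q u)) *\<^sub>R H u - 2 *\<^sub>R grad_q u)"
proof -
  let ?m = "real CARD('m)"
  have qx: "laplacian x (\<lambda>u. q u *\<^sub>R x u) u
      = laplacian x q u *\<^sub>R x u + q u *\<^sub>R laplacian x x u - 2 *\<^sub>R grad_q u"
    by (simp add: laplacian_bounded_bilinear[OF open_W u bounded_bilinear_scaleR twice_diff_on_q twice_diff_on_x]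
        grad_q_def)
  have "laplacian x (A 2) u
      = laplacian x (\<lambda>u. (?m\<^sup>2 *\<^sub>R x u + ?m\<^sup>2 *\<^sub>R (q u *\<^sub>R x u)) + (- 2 * ?m\<^sup>2) *\<^sub>R H u) u"
    by (rule laplacian_cong[OF open_W u]) (simp add: A_2 algebra_simps)
  also have "\<dots> = (?m\<^sup>2 *\<^sub>R laplacian x x u + ?m\<^sup>2 *\<^sub>R laplacian x (\<lambda>u. q u *\<^sub>R x u) u)
      + (- 2 * ?m\<^sup>2) *\<^sub>R laplacian x H u"
    by (simp only: laplacian_add[OF open_W u] twice_diff_on_add[OF open_W] twice_diff_on_scaleR_const[OF open_W]
        twice_diff_on_scaleR[OF open_W] twice_diff_on_q twice_diff_on_x twice_diff_on_H
        laplacian_bounded_linear[OF open_W u bounded_linear_scaleR_right])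
  also have "\<dots> = ?m\<^sup>2 *\<^sub>R (laplacian x x u + (laplacian x q u *\<^sub>R x u + q u *\<^sub>R laplacian x x u - 2 *\<^sub>R grad_q u)
      - 2 *\<^sub>R laplacian x H u)"
    by (simp add: qx scaleR_add_right scaleR_diff_right)
  also have "laplacian x x u + (laplacian x q u *\<^sub>R x u + q u *\<^sub>R laplacian x x u - 2 *\<^sub>R grad_q u)
      - 2 *\<^sub>R laplacian x H u = (laplacian x q u + 3 * ?m * q u + ?m) *\<^sub>R x u
    - (?m * (3 + q u)) *\<^sub>R H u - 2 *\<^sub>R grad_q u"
    unfolding laplacian_x[OF u] lap_H[OF u]
    by (rule euclidean_eqI) (simp add: inner_simps algebra_simps)
  finally show ?thesis
    using laplacian_A[OF u, of 2] by (simp add: numeral_3_eq_3 numeral_2_eq_2)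
qed

lemma q_locally_constant:
  assumes cubic: "\<And>j. j \<in> J \<Longrightarrow> \<mu> j ^ 3 - s1 * \<mu> j ^ 2 + s2 * \<mu> j - s3 = 0"
    and u0: "u0 \<in> W"
  obtains r where "r > 0" "ball u0 r \<subseteq> W" "\<And>u. u \<in> ball u0 r \<Longrightarrow> q u = q u0"
proof -
  let ?m = "real CARD('m)"
  have m: "?m > 0" by simp
  have rel: "A 3 u - s1 *\<^sub>R A 2 u + s2 *\<^sub>R A 1 u - s3 *\<^sub>R x u + s3 *\<^sub>R c = 0" if u: "u \<in> W" for u
  proof -
    have "A 3 u - s1 *\<^sub>R A 2 u + s2 *\<^sub>R A 1 u - s3 *\<^sub>R A 0 u
        = (\<Sum>j\<in>J. (\<mu> j ^ 3 - s1 * \<mu> j ^ 2 + s2 * \<mu> j - s3) *\<^sub>R \<psi> j u)"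
      by (simp add: comb_def scaleR_sum_right scaleR_diff_left scaleR_add_left sum.distrib sum_subtractf)
    also have "\<dots> = 0"
      by (intro sum.neutral ballI) (simp add: cubic)
    finally show ?thesis
      by (simp add: x_eq[OF u] scaleR_add_right)
  qed
  define h where "h u = s3 * (c \<bullet> x u)" for u
  \<comment> \<open>Taking \<open>w\<close> to be \<open>x u\<close>, \<open>H u\<close> and
    \<open>pd k x u\<close> yields \<open>E1\<close>, \<open>E2\<close> and \<open>E3\<close>;
    \<open>grad_q\<close> is seen only by the last.\<close>
  have dot: "(A 3 u \<bullet> w) - s1 * (A 2 u \<bullet> w) + s2 * (A 1 u \<bullet> w) - s3 * (x u \<bullet> w) + s3 * (c \<bullet> w) = 0"
    if "u \<in> W" for u w
    using arg_cong[OF rel[OF that], of "\<lambda>v. v \<bullet> w"] by (simp add: inner_add_left inner_diff_left)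
  have E1: "?m\<^sup>2 * laplacian x q u = - h u + s3 - s2 * ?m + s1 * ?m\<^sup>2 * (1 + q u) - ?m ^ 3 * (1 + 3 * q u)"
    if u: "u \<in> W" for u
  proof -
    have "A 3 u \<bullet> x u = ?m\<^sup>2 * (laplacian x q u + 3 * ?m * q u + ?m)"
      unfolding A_3[OF u] by (simp add: inner_diff_left x_inner_x[OF u] H_inner_x[OF u] grad_q_inner[OF u])
    moreover have "A 2 u \<bullet> x u = ?m\<^sup>2 * (1 + q u)"
      unfolding A_2[OF u] by (simp add: inner_diff_left x_inner_x[OF u] H_inner_x[OF u])
    moreover have "A 1 u \<bullet> x u = ?m"
      unfolding A_1[OF u] by (simp add: inner_diff_left x_inner_x[OF u] H_inner_x[OF u])
    ultimately show ?thesis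
      using dot[OF u, of "x u"]
      by (simp add: x_inner_x[OF u] h_def algebra_simps power2_eq_square power3_eq_cube)
  qed
  have E2: "s3 * (c \<bullet> H u) = ?m ^ 3 * (q u)\<^sup>2 + (3 * ?m ^ 3 - 2 * s1 * ?m\<^sup>2 + s2 * ?m) * q u"
    if u: "u \<in> W" for u
  proof -
    have xH: "x u \<bullet> H u = 0" using H_inner_x[OF u] by (simp add: inner_commute)
    have "A 3 u \<bullet> H u = - (?m\<^sup>2 * (?m * (3 + q u) * q u))"
      unfolding A_3[OF u] by (simp add: inner_diff_left xH grad_q_inner[OF u] q_def)
    moreover have "A 2 u \<bullet> H u = - (2 * ?m\<^sup>2 * q u)"
      unfolding A_2[OF u] by (simp add: inner_diff_left xH q_def)
    moreover have "A 1 u \<bullet> H u = - (?m * q u)"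
      unfolding A_1[OF u] by (simp add: inner_diff_left xH q_def)
    ultimately show ?thesis
      using dot[OF u, of "H u"]
      by (simp add: xH algebra_simps power2_eq_square power3_eq_cube)
  qed
  have E3: "s3 * (c \<bullet> pd k x u) = 2 * ?m\<^sup>2 * pd k q u" if u: "u \<in> W" for u k
  proof -
    have xp: "x u \<bullet> pd k x u = 0" using pd_x_inner_x[OF u] by (simp add: inner_commute)
    have "A 3 u \<bullet> pd k x u = - 2 * ?m\<^sup>2 * pd k q u"
      unfolding A_3[OF u] by (simp add: inner_diff_left xp H_inner_pd_x[OF u] grad_q_inner[OF u])
    moreover have "A 2 u \<bullet> pd k x u = 0"
      unfolding A_2[OF u] by (simp add: inner_diff_left xp H_inner_pd_x[OF u])
    moreover have "A 1 u \<bullet> pd k x u = 0"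
      unfolding A_1[OF u] by (simp add: inner_diff_left xp H_inner_pd_x[OF u])
    ultimately show ?thesis
      using dot[OF u, of "pd k x u"] by (simp add: xp)
  qed
  have bl: "bounded_linear (\<lambda>v. s3 * (c \<bullet> v))"
    by (intro bounded_linear_const_mult bounded_linear_inner_right)
  have bq: "bounded_linear (\<lambda>t. - 2 * ?m\<^sup>2 * t)"
    by (intro bounded_linear_const_mult bounded_linear_ident)
  have h_td: "twice_diff_on W h"
    unfolding h_def[abs_def] by (rule twice_diff_on_bounded_linear[OF open_W bl twice_diff_on_x])
  have q_td: "twice_diff_on W (\<lambda>u. - 2 * ?m\<^sup>2 * q u)"
    by (rule twice_diff_on_bounded_linear[OF open_W bq twice_diff_on_q])
  define f where "f u = h u + - 2 * ?m\<^sup>2 * q u" for u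
  have f_td: "twice_diff_on W f"
    unfolding f_def[abs_def] by (rule twice_diff_on_add[OF open_W h_td q_td])
  have pd_f: "pd k f u = 0" if u: "u \<in> W" for k u
  proof -
    have "pd k f u = pd k h u + pd k (\<lambda>u. - 2 * ?m\<^sup>2 * q u) u"
      unfolding f_def[abs_def] by (rule pd_add[OF twice_diff_onD(1)[OF h_td u] twice_diff_onD(1)[OF q_td u]])
    also have "pd k h u = s3 * (c \<bullet> pd k x u)"
      unfolding h_def[abs_def] by (rule pd_bounded_linear[OF bl twice_diff_onD(1)[OF twice_diff_on_x u]])
    also have "pd k (\<lambda>u. - 2 * ?m\<^sup>2 * q u) u = - 2 * ?m\<^sup>2 * pd k q u"
      by (rule pd_bounded_linear[OF bq twice_diff_onD(1)[OF twice_diff_on_q u]])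
    finally show ?thesis
      by (simp add: E3[OF u])
  qed
  have E4: "2 * ?m\<^sup>2 * laplacian x q u = ?m * h u - ?m * (s3 * (c \<bullet> H u))" if u: "u \<in> W" for u
  proof -
    have "0 = laplacian x f u"
      by (rule laplacian_eq_0[OF open_W u pd_f, symmetric])
    also have "\<dots> = laplacian x h u + laplacian x (\<lambda>u. - 2 * ?m\<^sup>2 * q u) u"
      unfolding f_def[abs_def] by (rule laplacian_add[OF open_W u h_td q_td])
    also have "laplacian x h u = s3 * (c \<bullet> laplacian x x u)"
      unfolding h_def[abs_def] by (rule laplacian_bounded_linear[OF open_W u bl twice_diff_on_x])
    also have "laplacian x (\<lambda>u. - 2 * ?m\<^sup>2 * q u) u = - 2 * ?m\<^sup>2 * laplacian x q u"
      by (rule laplacian_bounded_linear[OF open_W u bq twice_diff_on_q])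
    finally show ?thesis
      by (simp add: laplacian_x[OF u] h_def inner_diff_right algebra_simps)
  qed
  obtain r where r: "r > 0" "ball u0 r \<subseteq> W"
    using open_W u0 open_contains_ball by blast
  have "f constant_on ball u0 r"
    by (rule constant_on_ball_if_pd_eq_0) (use r pd_f twice_diff_onD(1)[OF f_td] in auto)
  then obtain k where "\<And>u. u \<in> ball u0 r \<Longrightarrow> f u = k"
    by (auto simp: constant_on_def)
  then have h: "h u = 2 * ?m\<^sup>2 * q u + k" if "u \<in> ball u0 r" for u
    using that by (fastforce simp: f_def)
  \<comment> \<open>\<open>\<alpha>\<close> and \<open>\<beta>\<close> collect the coefficients that
    arise when twice \<open>E1\<close> is equated with \<open>E4\<close>, \<open>E2\<close> replaces
    the term with \<open>H\<close>, and \<open>h\<close> becomes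
    \<open>2 * ?m\<^sup>2 * q u + k\<close>.\<close>
  define \<alpha> where "\<alpha> = ?m * (3 * ?m ^ 3 - 2 * s1 * ?m\<^sup>2 + s2 * ?m) + 2 * (s1 * ?m\<^sup>2 - 3 * ?m ^ 3) - (?m + 2) * (2 * ?m\<^sup>2)"
  define \<beta> where "\<beta> = 2 * (s3 - s2 * ?m + s1 * ?m\<^sup>2 - ?m ^ 3) - (?m + 2) * k"
  have "?m ^ 4 * (q u)\<^sup>2 + \<alpha> * q u + \<beta> = 0" if u: "u \<in> ball u0 r" for u
  proof -
    have uW: "u \<in> W" using u r by auto
    have "2 * (- h u + s3 - s2 * ?m + s1 * ?m\<^sup>2 * (1 + q u) - ?m ^ 3 * (1 + 3 * q u))
        = ?m * h u - ?m * (?m ^ 3 * (q u)\<^sup>2 + (3 * ?m ^ 3 - 2 * s1 * ?m\<^sup>2 + s2 * ?m) * q u)"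
      using E4[OF uW] unfolding E2[OF uW] E1[OF uW, symmetric] by simp
    then show ?thesis
      unfolding h[OF u] \<alpha>_def \<beta>_def by algebra
  qed
  \<comment> \<open>A continuous image of a ball that lies in a finite set of reals is a single
    point.\<close>
  then have "q ` ball u0 r \<subseteq> {t. ?m ^ 4 * t\<^sup>2 + \<alpha> * t + \<beta> = 0}"
    by auto
  then have "finite (q ` ball u0 r)"
    using finite_quadratic_roots[of "?m ^ 4" \<alpha> \<beta>] finite_subset by auto
  moreover have "connected (q ` ball u0 r)"
    by (intro connected_continuous_image continuous_on_subset[OF twice_diff_on_continuous_on[OF twice_diff_on_q] r(2)]) simp
  ultimately obtain t where "q ` ball u0 r = {t}"
    using connected_finite_iff_sing[of "q ` ball u0 r"] r(1) by auto
  then have "q u = q u0" if "u \<in> ball u0 r" for u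
    using that r(1) by (metis centre_in_ball imageI singletonD)
  with r that show thesis by blast
qed

end

text \<open>This is (D - m)^2 x = m^2 k x on x = c + (sum of eigenmaps), with the terms in
  \<open>c\<close> moved to the right.\<close>

lemma (in biharmonic_spectral) comb_eq_if_q:
  assumes u: "u \<in> W" and k: "q u = k"
  shows "comb (\<lambda>j. (\<mu> j - real CARD('m))\<^sup>2 - (real CARD('m))\<^sup>2 * k) u = ((real CARD('m))\<^sup>2 * (k - 1)) *\<^sub>R c"
proof -
  let ?m = "real CARD('m)"
  have e: "(\<mu> j - ?m)\<^sup>2 - ?m\<^sup>2 * k = \<mu> j ^ 2 - 2 * ?m * \<mu> j + ?m\<^sup>2 * (1 - k)" for j
    by algebra
  have "comb (\<lambda>j. (\<mu> j - ?m)\<^sup>2 - ?m\<^sup>2 * k) u = A 2 u - (2 * ?m) *\<^sub>R A 1 u + (?m\<^sup>2 * (1 - k)) *\<^sub>R A 0 u"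
    unfolding comb_def e
    by (simp add: scaleR_sum_right scaleR_diff_left scaleR_add_left sum.distrib sum_subtractf)
  also have "A 0 u = x u - c"
    using x_eq[OF u] by simp
  also have "A 2 u - (2 * ?m) *\<^sub>R A 1 u = (?m\<^sup>2 * (k - 1)) *\<^sub>R x u"
    unfolding A_2[OF u] A_1[OF u] k
    by (rule euclidean_eqI) (simp add: inner_simps algebra_simps power2_eq_square)
  finally show ?thesis
    by (simp add: algebra_simps)
qed

text \<open>The first application of D kills the constant and puts a factor \<open>\<mu> j\<close>
  on each term; further applications raise its power.\<close>

lemma (in biharmonic_spectral) comb_power_eq_0:
  assumes const: "\<And>u. u \<in> W \<Longrightarrow> comb e u = d" and u: "u \<in> W"
  shows "comb (\<lambda>j. \<mu> j ^ n * (e j * \<mu> j)) u = 0"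
  using u
proof (induction n arbitrary: u)
  case 0
  have "laplacian x (comb e) u = laplacian x (\<lambda>u. d) u"
    by (rule laplacian_cong[OF open_W 0 const])
  then show ?case
    by (simp add: laplacian_comb[OF 0])
next
  case (Suc n)
  have "laplacian x (comb (\<lambda>j. \<mu> j ^ n * (e j * \<mu> j))) u = laplacian x (\<lambda>u. 0) u"
    by (rule laplacian_cong[OF open_W Suc.prems Suc.IH])
  then show ?case
    by (simp add: laplacian_comb[OF Suc.prems] mult_ac)
qed

text \<open>Subtracting \<open>\<mu> a\<close> times the relation for \<open>n\<close> from that for
  \<open>Suc n\<close> removes the index \<open>a\<close> and scales the other vectors by nonzero
  factors.\<close>

lemma vandermonde_eq_0:
  fixes \<mu> :: "'j \<Rightarrow> real" and w :: "'j \<Rightarrow> 'a::real_vector"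
  assumes "finite J" "inj_on \<mu> J" "\<And>n. (\<Sum>j\<in>J. \<mu> j ^ n *\<^sub>R w j) = 0" "j \<in> J"
  shows "w j = 0"
  using assms
proof (induction J arbitrary: w j rule: finite_induct)
  case (insert a J)
  have "(\<Sum>j\<in>J. \<mu> j ^ n *\<^sub>R ((\<mu> j - \<mu> a) *\<^sub>R w j)) = 0" for n
  proof -
    have "(\<Sum>j\<in>J. \<mu> j ^ n *\<^sub>R ((\<mu> j - \<mu> a) *\<^sub>R w j))
        = (\<Sum>j\<in>insert a J. \<mu> j ^ n *\<^sub>R ((\<mu> j - \<mu> a) *\<^sub>R w j))"
      using insert.hyps by simp
    also have "\<dots> = (\<Sum>j\<in>insert a J. \<mu> j ^ Suc n *\<^sub>R w j) - \<mu> a *\<^sub>R (\<Sum>j\<in>insert a J. \<mu> j ^ n *\<^sub>R w j)"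
      unfolding scaleR_sum_right sum_subtractf[symmetric] by (simp add: algebra_simps)
    finally show ?thesis
      by (simp only: insert.prems(2) scaleR_zero_right diff_self)
  qed
  then have J: "w i = 0" if "i \<in> J" for i
    using insert.IH[of "\<lambda>j. (\<mu> j - \<mu> a) *\<^sub>R w j" i] insert.prems(1) insert.hyps(2) that
    by (force simp: image_iff)
  then have "w a = 0"
    using insert.prems(2)[of 0] insert.hyps by simp
  then show ?case
    using J insert.prems(3) by auto
qed simp

section \<open>From charts to the whole manifold\<close>

lemma chart_openin_image:
  assumes "chart M W x" "open B" "B \<subseteq> W"
  shows "openin M (x ` B)"
proof -
  have "open_map (top_of_set W) (subtopology M (x ` W)) x"
    using assms(1) homeomorphic_imp_open_map by (auto simp: chart_def)
  moreover have "openin (top_of_set W) B"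
    using assms(1-3) by (simp add: chart_def openin_open_eq)
  ultimately have "openin (subtopology M (x ` W)) (x ` B)"
    by (simp add: open_map_def)
  then show ?thesis
    using assms(1) openin_trans_full by (auto simp: chart_def)
qed

lemma chart_in_topspace: "chart M W x \<Longrightarrow> u \<in> W \<Longrightarrow> x u \<in> topspace M"
  using openin_subset by (fastforce simp: chart_def)

lemma locally_constant_imp_constant_on_submanifold:
  fixes M :: "'a::euclidean_space topology"
  assumes M: "submanifold TYPE('m::finite) M"
    and loc: "\<And>W (x :: real^'m \<Rightarrow> 'a) u. chart M W x \<Longrightarrow> u \<in> W \<Longrightarrow>
      \<exists>r>0. ball u r \<subseteq> W \<and> (\<forall>v\<in>ball u r. f (x v) = f (x u))"
  shows "f constant_on topspace M"
proof -
  \<comment> \<open>A general \<open>P\<close> covers a level set of \<open>f\<close> and its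
    complement at once.\<close>
  have "openin M {p \<in> topspace M. P (f p)}" for P
  proof (subst openin_subopen, intro ballI)
    fix p assume p: "p \<in> {p \<in> topspace M. P (f p)}"
    then obtain W and x :: "real^'m \<Rightarrow> 'a" where W: "chart M W x" "p \<in> x ` W"
      using M by (auto simp: submanifold_def)
    then obtain u where u: "u \<in> W" "p = x u" by blast
    obtain r where r: "r > 0" "ball u r \<subseteq> W" "\<forall>v\<in>ball u r. f (x v) = f (x u)"
      using loc[OF W(1) u(1)] by blast
    show "\<exists>T. openin M T \<and> p \<in> T \<and> T \<subseteq> {p \<in> topspace M. P (f p)}"
    proof (intro exI conjI)
      show "openin M (x ` ball u r)"
        by (rule chart_openin_image[OF W(1) open_ball r(2)])
      show "p \<in> x ` ball u r"
        using r(1) u(2) by simp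
      show "x ` ball u r \<subseteq> {p \<in> topspace M. P (f p)}"
      proof (rule image_subsetI)
        fix v assume v: "v \<in> ball u r"
        have "f (x v) = f p"
          unfolding u(2) by (rule r(3)[rule_format, OF v])
        then show "x v \<in> {p \<in> topspace M. P (f p)}"
          using p r(2) v chart_in_topspace[OF W(1), of v] by auto
      qed
    qed
  qed
  note op = this
  have conn: "connected_space M"
    using M by (simp add: submanifold_def)
  have "f p = f p'" if "p \<in> topspace M" "p' \<in> topspace M" for p p'
  proof (rule ccontr)
    assume "f p \<noteq> f p'"
    let ?E = "{z \<in> topspace M. f z = f p}" and ?E' = "{z \<in> topspace M. f z \<noteq> f p}"
    have "openin M ?E" "openin M ?E'"
      using op[of "\<lambda>t. t = f p"] op[of "\<lambda>t. t \<noteq> f p"] by auto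
    moreover have "topspace M \<subseteq> ?E \<union> ?E'" "?E \<inter> ?E' = {}"
      by auto
    moreover have "p \<in> ?E" "p' \<in> ?E'"
      using that \<open>f p \<noteq> f p'\<close>[symmetric] by simp_all
    ultimately show False
      using conn unfolding connected_space_def by blast
  qed
  then show ?thesis
    unfolding constant_on_def by metis
qed

section \<open>Constancy of q on M and the clash of three eigenvalues\<close>

lemma no_biharmonic_3_type:
  fixes M :: "'a::euclidean_space topology"
  assumes M: "submanifold TYPE('m::finite) M" and sphere: "topspace M \<subseteq> sphere 0 1"
    and bih: "biharmonic TYPE('m) M" and ft: "finite_type TYPE('m) 3 M"
  shows False
proof -
  let ?m = "real CARD('m)"
  obtain c :: 'a and F :: "nat \<Rightarrow> 'a \<Rightarrow> 'a" and \<mu> :: "nat \<Rightarrow> real" where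
    inj_\<mu>: "inj_on \<mu> {..<3}" and eig: "\<And>i. i < 3 \<Longrightarrow> eigenmap TYPE('m) M (\<mu> i) (F i)"
    and nonconst: "\<And>i. i < 3 \<Longrightarrow> \<not> F i constant_on topspace M"
    and dec: "\<And>p. p \<in> topspace M \<Longrightarrow> p = c + (\<Sum>i<3. F i p)"
    using ft unfolding finite_type_def by blast
  have spectral: "biharmonic_spectral x W {..<3} c (\<lambda>j. F j \<circ> x) \<mu>"
    if W: "chart M W x" for W and x :: "real^'m \<Rightarrow> 'a"
  proof
    show "open W" "smooth_on W x" using W by (simp_all add: chart_def)
    show "inj (frechet_derivative x (at u))" if "u \<in> W" for u
      using W that by (simp add: chart_def)
    show "x u \<in> sphere 0 1" if "u \<in> W" for u
      using sphere chart_in_topspace[OF W that] by blast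
    show "smooth_on W (F j \<circ> x)" if "j \<in> {..<3}" for j
      using eig[of j] W that by (simp add: eigenmap_def smooth_map_def)
    show "laplacian x (F j \<circ> x) u = \<mu> j *\<^sub>R (F j \<circ> x) u" if "j \<in> {..<3}" "u \<in> W" for j u
      using eig[of j] W that by (simp add: eigenmap_def)
    show "x u = c + (\<Sum>j<3. (F j \<circ> x) u)" if "u \<in> W" for u
      using dec[OF chart_in_topspace[OF W that]] by simp
    show "rough_laplacian x (mean_curvature x) u
      + mtrace x u (\<lambda>i j. sphere_curv (x u) (pd i x u) (mean_curvature x u) (pd j x u)) = 0" if "u \<in> W" for u
      using bih W that by (simp add: biharmonic_def)
  qed
  \<comment> \<open>Elementary symmetric functions: the cubic is the monic one whose roots are the
    three eigenvalues.\<close>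
  define s1 s2 s3 where "s1 = \<mu> 0 + \<mu> 1 + \<mu> 2"
    and "s2 = \<mu> 0 * \<mu> 1 + \<mu> 0 * \<mu> 2 + \<mu> 1 * \<mu> 2" and "s3 = \<mu> 0 * \<mu> 1 * \<mu> 2"
  have less_3: "j < 3 \<longleftrightarrow> j = 0 \<or> j = 1 \<or> j = 2" for j :: nat
    by auto
  have cubic: "\<mu> j ^ 3 - s1 * \<mu> j ^ 2 + s2 * \<mu> j - s3 = 0" if "j \<in> {..<3}" for j
    using that unfolding lessThan_iff less_3 s1_def s2_def s3_def
    by (elim disjE) (simp_all add: power2_eq_square power3_eq_cube algebra_simps)
  \<comment> \<open>The mean curvature vector written without charts, so that its squared length is
    a function on M.\<close>
  define h where "h p = p - (1 / ?m) *\<^sub>R (\<Sum>j<3. \<mu> j *\<^sub>R F j p)" for p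
  have "(\<lambda>p. h p \<bullet> h p) constant_on topspace M"
  proof (rule locally_constant_imp_constant_on_submanifold[OF M])
    fix W u and x :: "real^'m \<Rightarrow> 'a" assume W: "chart M W x" and u: "u \<in> W"
    interpret biharmonic_spectral x W "{..<3}" c "\<lambda>j. F j \<circ> x" \<mu>
      by (rule spectral[OF W])
    have h: "h (x v) \<bullet> h (x v) = q v" if "v \<in> W" for v
      using H_eq_A[OF that] by (simp add: h_def q_def comb_def)
    from q_locally_constant[OF cubic u] obtain r where
      "r > 0" "ball u r \<subseteq> W" "\<And>v. v \<in> ball u r \<Longrightarrow> q v = q u" by blast
    then show "\<exists>r>0. ball u r \<subseteq> W \<and> (\<forall>v\<in>ball u r. h (x v) \<bullet> h (x v) = h (x u) \<bullet> h (x u))"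
      using h u by (metis subsetD)
  qed
  then obtain k where k: "\<And>p. p \<in> topspace M \<Longrightarrow> h p \<bullet> h p = k"
    by (auto simp: constant_on_def)
  define e where "e j = (\<mu> j - ?m)\<^sup>2 - ?m\<^sup>2 * k" for j
  define d where "d = (?m\<^sup>2 * (k - 1)) *\<^sub>R c"
  \<comment> \<open>The second conjunct says nothing about an eigenmap with eigenvalue 0; the first
    is kept for that case.\<close>
  have sum_eF: "(\<Sum>j<3. e j *\<^sub>R F j p) = d \<and> (\<forall>j<3. (e j * \<mu> j) *\<^sub>R F j p = 0)" if p: "p \<in> topspace M" for p
  proof -
    obtain W and x :: "real^'m \<Rightarrow> 'a" and u where W: "chart M W x" and u: "u \<in> W" "p = x u"
      using M p unfolding submanifold_def by blast
    interpret biharmonic_spectral x W "{..<3}" c "\<lambda>j. F j \<circ> x" \<mu>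
      by (rule spectral[OF W])
    have "q v = k" if "v \<in> W" for v
      using H_eq_A[OF that] k[OF chart_in_topspace[OF W that]] by (simp add: h_def q_def comb_def)
    then have const: "comb e v = d" if "v \<in> W" for v
      using comb_eq_if_q[OF that] that by (simp add: e_def[abs_def] d_def)
    have "(\<Sum>j<3. \<mu> j ^ n *\<^sub>R ((e j * \<mu> j) *\<^sub>R F j p)) = 0" for n
      using comb_power_eq_0[OF const u(1), of n] by (simp add: comb_def u(2))
    from vandermonde_eq_0[OF _ inj_\<mu> this] const[OF u(1)] show ?thesis
      by (simp add: comb_def u(2))
  qed
  have e\<mu>: "e j * \<mu> j = 0" if j: "j < 3" for j
  proof (rule ccontr)
    assume "e j * \<mu> j \<noteq> 0"
    then have "F j p = 0" if "p \<in> topspace M" for p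
      using sum_eF[OF that] j by auto
    then show False
      using nonconst[OF j] by (auto simp: constant_on_def)
  qed
  \<comment> \<open>If \<open>e j\<close> were nonzero, \<open>\<mu> j\<close> would be 0. The other
    eigenvalues are then nonzero, so their coefficients vanish and the sum reduces to
    \<open>e j *\<^sub>R F j p = d\<close>, contradicting that \<open>F j\<close> is
    nonconstant.\<close>
  have e0: "e j = 0" if j: "j < 3" for j
  proof (rule ccontr)
    assume ej: "e j \<noteq> 0"
    then have "\<mu> j = 0" using e\<mu>[OF j] by simp
    then have "e i = 0" if "i < 3" "i \<noteq> j" for i
      using e\<mu>[OF that(1)] inj_onD[OF inj_\<mu>, of i j] that j by auto
    then have "(\<Sum>i<3. e i *\<^sub>R F i p) = e j *\<^sub>R F j p" for p
      using j by (subst sum.remove[of _ j]) auto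
    then have "e j *\<^sub>R F j p = d" if "p \<in> topspace M" for p
      using sum_eF[OF that] by simp
    then have "F j p = (1 / e j) *\<^sub>R d" if "p \<in> topspace M" for p
      using that ej by (metis divide_self_if scaleR_one scaleR_scaleR times_divide_eq_left mult_1)
    then show False
      using nonconst[OF j] by (auto simp: constant_on_def)
  qed
  \<comment> \<open>Distinct roots of (t - m)^2 = m^2 k are symmetric about m. Pairing index 0 with
    1 and with 2 then forces \<open>\<mu> 1 = \<mu> 2\<close>.\<close>
  have sum_\<mu>: "\<mu> i + \<mu> j = 2 * ?m" if "i < 3" "j < 3" "i \<noteq> j" for i j
  proof -
    have "\<mu> i \<noteq> \<mu> j"
      using inj_onD[OF inj_\<mu>, of i j] that by auto
    moreover have "(\<mu> i - \<mu> j) * (\<mu> i + \<mu> j - 2 * ?m) = e i - e j"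
      by (simp add: e_def power2_eq_square algebra_simps)
    ultimately show ?thesis
      using e0[OF that(1)] e0[OF that(2)] by simp
  qed
  have "\<mu> 1 = \<mu> 2"
    using sum_\<mu>[of 0 1] sum_\<mu>[of 0 2] by simp
  then show False
    using inj_onD[OF inj_\<mu>, of 1 2] by simp
qed

theorem corollary5p11:
  assumes "CARD('n::finite) = CARD('m::finite) + 2"
  shows "\<not> (\<exists>M :: (real^'n) topology.
           submanifold TYPE('m) M \<and> topspace M \<subseteq> sphere 0 1 \<and>
           biharmonic TYPE('m) M \<and> finite_type TYPE('m) 3 M)"
  using no_biharmonic_3_type by blast

end
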